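(* Let $0\le\alpha_1<\cdots<\alpha_n\le\frac{\pi}{2}$ and $T>0$. Let $f_1,\ldots,f_n\in L^\infty(\mathbb{R})$ with $\operatorname{supp}f_j\subset[-T,T]$ and $f_j\ge0$. Then for every $\varepsilon>0$ there exists $\varphi\in L^2(\mathbb{R})$ such that for every $k=1,\ldots,n$, \[ \bigl\|\,|\mathcal{F}_{\alpha_k}[\varphi]|-f_k\bigr\|_{L^\infty([-T,T])}\le\varepsilon . \]
   Context: For $\alpha\in\mathbb{R}\setminus\pi\mathbb{Z}$ and $f\in L^1(\mathbb{R})\cap L^2(\mathbb{R})$, the fractional Fourier transform is $\mathcal{F}_\alpha f(\xi)=c_\alpha e^{-i\pi\cot\alpha\,\xi^2}\int_{\mathbb{R}}e^{-i\pi\cot\alpha\,x^2}e^{-2i\pi x\xi/\sin\alpha}f(x)\,\mathrm{d}x$ with $c_\alpha=\exp\bigl(\frac i2(\alpha-\mathrm{sgn}(\alpha)\frac\pi4)\bigr)/\sqrt{|\sin\alpha|}$, extended to a unitary operator on $L^2(\mathbb{R})$; for $\alpha=k\pi$, $k\in\mathbb{Z}$, $\mathcal{F}_\alpha g(\xi)=g((-1)^k\xi)$. These satisfy $\mathcal{F}_\alpha\mathcal{F}_\beta=\mathcal{F}_{\alpha+\beta}$ and $\mathcal{F}_{\pi/2}$ is the Fourier transform. *)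

theory Defs
  imports "HOL-Analysis.Analysis"
begin

definition frft_int :: "real \<Rightarrow> (real \<Rightarrow> complex) \<Rightarrow> real \<Rightarrow> complex" where
  "frft_int \<alpha> f \<xi> =
     (if \<alpha> \<in> range (\<lambda>k::int. real_of_int k * pi)
      then f ((-1) powi (THE k::int. \<alpha> = real_of_int k * pi) * \<xi>)
      else
        (exp (\<i> / 2 * complex_of_real (\<alpha> - sgn \<alpha> * pi / 4)) / complex_of_real (sqrt \<bar>sin \<alpha>\<bar>))
        * exp (- \<i> * complex_of_real (pi * cot \<alpha> * \<xi>\<^sup>2))
        * (LINT x|lborel. exp (- \<i> * complex_of_real (pi * cot \<alpha> * x\<^sup>2))
                         * exp (- 2 * \<i> * complex_of_real (pi * x * \<xi> / sin \<alpha>)) * f x))"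

definition L2 :: "(real \<Rightarrow> complex) \<Rightarrow> bool" where
  "L2 f \<longleftrightarrow> f \<in> borel_measurable lborel \<and> integrable lborel (\<lambda>x. (cmod (f x))\<^sup>2)"

text \<open>Truncation to [-n,n]; for f in L^2 this lies in L^1 \<inter> L^2 and converges to f in L^2.\<close>
definition trunc :: "nat \<Rightarrow> (real \<Rightarrow> complex) \<Rightarrow> real \<Rightarrow> complex" where
  "trunc n f x = (if x \<in> {- real n .. real n} then f x else 0)"

text \<open>g is (a representative of) the unitary L^2 extension of the fractional Fourier transform
  applied to f: the L^2-limit of the transforms of the truncations of f.\<close>
definition frft_L2 :: "real \<Rightarrow> (real \<Rightarrow> complex) \<Rightarrow> (real \<Rightarrow> complex) \<Rightarrow> bool" where
  "frft_L2 \<alpha> f g \<longleftrightarrow> L2 g \<and>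
     ((\<lambda>n. \<integral>\<^sup>+ \<xi>. ennreal ((cmod (frft_int \<alpha> (trunc n f) \<xi> - g \<xi>))\<^sup>2) \<partial>lborel)
        \<longlongrightarrow> 0) sequentially"

end

(* Take phi = sum_j V_j (e^{iNx} f_j), where V_j inverts the fractional Fourier transform F_j of
   angle alpha_j. Then F_k phi is e^{iNx} f_k plus the cross terms F_k V_j (e^{iNx} f_j), j \<noteq> k.
   Since alpha_k and alpha_j are distinct, F_k V_j is again an integral transform with kernel
   const * e^{i(p xi^2 + a x xi + q x^2)}, a \<noteq> 0, and modulating its argument by e^{iNx} translates the
   output by N/a. By the Riemann-Lebesgue lemma the cross terms are therefore uniformly small on
   [-T,T] once N is large, while |e^{iNx} f_k| = f_k.

   As V_j (e^{iNx} f_j) need not be integrable, the transforms are only defined by L^2 limits. The limits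
   are identified by Plancherel's theorem for bounded functions of compact support, and the kernel
   of F_k V_j by evaluating a Fresnel integral. *)
theory Submission
  imports Defs "HOL-Probability.Characteristic_Functions"
begin

section \<open>Bounded functions with compact support\<close>

text \<open>Every L^2 limit is identified by a single criterion: an isometric kernel sends u to G as
  soon as G and u have equal norms and the adjoint kernel, applied to the truncations of G,
  converges boundedly and pointwise to u. A candidate transform can thus be guessed and then checked
  through the adjoint, where only pointwise limits of integrals have to be computed. For F_k V_j the
  guess is forced by matching quadratic phases, which is possible because the cotangents of the two
  angles differ; angle 0, where the transform is the identity and has no kernel, is treated apart.
  The check meets an oscillatory integrand of modulus 1. Besides the limit of the Fresnel integral
  it therefore takes a bound uniform in the endpoint and in the linear phase, to serve as a
  dominating constant. The kernel formula controls the cross terms pointwise, for one specific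
  representative of the transform; almost everywhere uniqueness carries the estimate over to every
  representative.\<close>

lemma cmod_mult_cnj_real: "z * cnj z = complex_of_real ((cmod z)\<^sup>2)"
  using complex_norm_square[of z] by simp

lemma borel_measurable_cis [measurable]:
  "f \<in> borel_measurable M \<Longrightarrow> (\<lambda>x. cis (f x)) \<in> borel_measurable M"
  by (rule measurable_compose[OF _ borel_measurable_continuous_onI])
     (auto intro!: continuous_intros)

lemma borel_measurable_cnj [measurable]:
  "f \<in> borel_measurable M \<Longrightarrow> (\<lambda>x. cnj (f x)) \<in> borel_measurable M"
  by (rule measurable_compose[OF _ borel_measurable_continuous_onI])
     (auto intro!: continuous_intros)

text \<open>Bounded with compact support.\<close>

definition bcs :: "(real \<Rightarrow> complex) \<Rightarrow> bool" where
  "bcs h \<longleftrightarrow> h \<in> borel_measurable borel \<and>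
     (\<exists>B R. B > 0 \<and> R > 0 \<and> (\<forall>x. cmod (h x) \<le> B \<and> (R < \<bar>x\<bar> \<longrightarrow> h x = 0)))"

lemma bcsE:
  assumes "bcs h"
  obtains B R where "B > 0" "R > 0" "\<And>x. cmod (h x) \<le> B" "\<And>x. R < \<bar>x\<bar> \<Longrightarrow> h x = 0"
  using assms by (auto simp: bcs_def)

lemma bcsI:
  assumes "h \<in> borel_measurable borel" "\<And>x. \<bar>x\<bar> \<le> R \<Longrightarrow> cmod (h x) \<le> B" "\<And>x. R < \<bar>x\<bar> \<Longrightarrow> h x = 0"
  shows "bcs h"
  unfolding bcs_def
proof (intro conjI exI allI impI)
  show "max 1 B > 0" "max 1 R > 0" by auto
  show "cmod (h x) \<le> max 1 B" for x
    using assms(2,3)[of x] by (cases "\<bar>x\<bar> \<le> R") auto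
  show "h x = 0" if "max 1 R < \<bar>x\<bar>" for x
    using assms(3)[of x] that by auto
qed (use assms in auto)

lemma bcs_measurable: "bcs h \<Longrightarrow> h \<in> borel_measurable borel"
  by (simp add: bcs_def)

lemma bcs_integrable: 
  assumes "bcs h" shows "integrable lborel h"
proof -
  obtain B R where "B > 0" "R > 0" "\<And>x. cmod (h x) \<le> B" "\<And>x. R < \<bar>x\<bar> \<Longrightarrow> h x = 0"
    using bcsE[OF assms] by blast
  then show ?thesis
    using bcs_measurable[OF assms]
    by (intro integrableI_bounded_set[where A="{-R..R}" and B=B]) auto
qed

lemma bcs_mult:
  assumes "bcs h" "u \<in> borel_measurable borel" "\<And>R. \<exists>B. \<forall>x. \<bar>x\<bar> \<le> R \<longrightarrow> cmod (u x) \<le> B"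
  shows "bcs (\<lambda>x. u x * h x)"
proof -
  obtain B R where h: "B > 0" "R > 0" "\<And>x. cmod (h x) \<le> B" "\<And>x. R < \<bar>x\<bar> \<Longrightarrow> h x = 0"
    using bcsE[OF assms(1)] by blast
  obtain C where C: "\<And>x. \<bar>x\<bar> \<le> R \<Longrightarrow> cmod (u x) \<le> C" using assms(3)[of R] by blast
  show ?thesis
  proof (rule bcsI[where R=R and B="C*B"])
    show "(\<lambda>x. u x * h x) \<in> borel_measurable borel"
      using assms(2) bcs_measurable[OF assms(1)] by auto
    show "cmod (u x * h x) \<le> C * B" if "\<bar>x\<bar> \<le> R" for x
      unfolding norm_mult
      by (rule mult_mono) (use C[OF that] h(3)[of x] order_trans[OF norm_ge_zero C[OF that]] in auto)
  qed (use h in auto)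
qed

lemma bcs_cis_mult: "bcs h \<Longrightarrow> w \<in> borel_measurable borel \<Longrightarrow> bcs (\<lambda>x. cis (w x) * h x)"
  by (rule bcs_mult) (auto intro!: exI[of _ 1])

lemma bcs_cnj:
  assumes "bcs h" shows "bcs (\<lambda>x. cnj (h x))"
proof -
  have "(\<lambda>x. cnj (h x)) \<in> borel_measurable borel"
    by (rule borel_measurable_cnj[OF bcs_measurable[OF assms]])
  with bcsE[OF assms] show ?thesis
    by (metis bcsI complex_mod_cnj complex_cnj_zero)
qed

lemma bcs_affine:
  assumes "bcs h" "c \<noteq> 0" shows "bcs (\<lambda>x. h (s + c * x))"
proof -
  obtain B R where h: "B > 0" "R > 0" "\<And>x. cmod (h x) \<le> B" "\<And>x. R < \<bar>x\<bar> \<Longrightarrow> h x = 0"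
    using bcsE[OF assms(1)] by blast
  have [measurable]: "h \<in> borel_measurable borel" by (rule bcs_measurable[OF assms(1)])
  show ?thesis
  proof (rule bcsI[where R="(R + \<bar>s\<bar>) / \<bar>c\<bar>" and B=B])
    fix x assume "(R + \<bar>s\<bar>) / \<bar>c\<bar> < \<bar>x\<bar>"
    then have "R + \<bar>s\<bar> < \<bar>c * x\<bar>"
      using assms(2) by (simp add: field_simps abs_mult)
    then show "h (s + c * x) = 0" by (intro h(4)) linarith
  qed (use h in auto)
qed

lemma bcs_diff: 
  assumes "bcs h" "bcs g" shows "bcs (\<lambda>x. h x - g x)"
proof -
  obtain B R where h: "B > 0" "R > 0" "\<And>x. cmod (h x) \<le> B" "\<And>x. R < \<bar>x\<bar> \<Longrightarrow> h x = 0"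
    using bcsE[OF assms(1)] by blast
  obtain B' R' where g: "B' > 0" "R' > 0" "\<And>x. cmod (g x) \<le> B'" "\<And>x. R' < \<bar>x\<bar> \<Longrightarrow> g x = 0"
    using bcsE[OF assms(2)] by blast
  show ?thesis
  proof (rule bcsI[where R="R + R'" and B="B + B'"])
    show "(\<lambda>x. h x - g x) \<in> borel_measurable borel"
      using assms[THEN bcs_measurable] by measurable
    show "cmod (h x - g x) \<le> B + B'" for x
      using h(3)[of x] g(3)[of x] norm_triangle_ineq4[of "h x" "g x"] by linarith
  qed (use h g in auto)
qed

lemma bcs_norm2_integrable: "bcs h \<Longrightarrow> integrable lborel (\<lambda>x. (cmod (h x))\<^sup>2)"
proof -
  assume h: "bcs h"
  have "bcs (\<lambda>x. cnj (h x) * h x)"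
    using bcs_measurable[OF h] by (intro bcs_mult[OF h]) (use h in \<open>auto elim!: bcsE\<close>)
  from integrable_norm[OF bcs_integrable[OF this]] show ?thesis
    by (simp add: norm_mult power2_eq_square)
qed

lemma bcs_trunc:
  assumes "u \<in> borel_measurable borel" "\<And>R. \<exists>B. \<forall>x. \<bar>x\<bar> \<le> R \<longrightarrow> cmod (u x) \<le> B"
  shows "bcs (trunc n u)"
proof -
  obtain B where B: "\<And>x. \<bar>x\<bar> \<le> real n \<Longrightarrow> cmod (u x) \<le> B" using assms(2)[of n] by auto
  have "trunc n u = (\<lambda>x. indicator {-real n..real n} x * u x)"
    by (auto simp: trunc_def fun_eq_iff)
  moreover have "(\<lambda>x. indicator {-real n..real n} x * u x) \<in> borel_measurable borel"
    using assms(1) by measurable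
  ultimately show ?thesis
    using B by (intro bcsI[of _ n B]) (auto simp: indicator_def)
qed

lemma trunc_bcs_eventually:
  assumes "bcs h" shows "eventually (\<lambda>n. trunc n h = h) sequentially"
proof -
  obtain B R where h: "B > 0" "R > 0" "\<And>x. cmod (h x) \<le> B" "\<And>x. R < \<bar>x\<bar> \<Longrightarrow> h x = 0"
    using bcsE[OF assms(1)] by blast
  have "trunc n h = h" if "n \<ge> nat \<lceil>R\<rceil>" for n
  proof -
    have "real n \<ge> R" using that by linarith
    then show ?thesis using h(4) by (auto simp: trunc_def fun_eq_iff abs_if)
  qed
  then show ?thesis unfolding eventually_sequentially by blast
qed

section \<open>Continuity of translation in L^1\<close>

text \<open>A measurable function is an almost everywhere limit of continuous ones. Bounding these
  in range and support keeps them continuous and gives a common integrable majorant, so dominated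
  convergence turns the pointwise limit into an L^1 limit.\<close>

lemma bcs_L1_approx_continuous:
  assumes "bcs h" "e > 0"
  obtains g where "continuous_on UNIV g" "bcs g" "(LINT x|lborel. cmod (g x - h x)) < e"
proof -
  obtain B R where h: "B > 0" "R > 0" "\<And>x. cmod (h x) \<le> B" "\<And>x. R < \<bar>x\<bar> \<Longrightarrow> h x = 0"
    using bcsE[OF assms(1)] by blast
  have hm[measurable]: "h \<in> borel_measurable borel" by (rule bcs_measurable[OF assms(1)])
  have "h measurable_on UNIV"
    by (rule lebesgue_measurable_imp_measurable_on) 
       (use hm in \<open>auto intro: measurable_completion\<close>)
  then obtain N g where N: "negligible N" and g: "\<And>n. continuous_on UNIV (g n)"
    and lim: "\<And>x. x \<notin> N \<Longrightarrow> (\<lambda>n::nat. g n x) \<longlonglongrightarrow> h x"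
    unfolding measurable_on_def by auto
  \<comment> \<open>\<open>c\<close> is 1 on [-R, R] and 0 beyond R + 1; the factor
    \<open>B / max B (cmod (g n x))\<close> projects values radially onto the disc of radius
    \<open>B\<close>. Neither changes the limit \<open>h x\<close>.\<close>
  define c where "c x = max 0 (min 1 (R + 1 - \<bar>x\<bar>))" for x :: real
  define k where "k n x = complex_of_real (c x * (B / max B (cmod (g n x)))) * g n x" for n x
  have kc: "continuous_on UNIV (k n)" for n
    unfolding k_def c_def using h(1) by (intro continuous_intros g) auto
  have kB: "cmod (k n x) \<le> B" for n x
  proof -
    have "B * cmod (g n x) \<le> B * max B (cmod (g n x))" using h(1) by auto
    then have "\<bar>B / max B (cmod (g n x))\<bar> * cmod (g n x) \<le> B"
      using h(1) by (simp add: field_simps)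
    moreover have "\<bar>c x\<bar> \<le> 1" by (auto simp: c_def)
    ultimately have "\<bar>c x\<bar> * (\<bar>B / max B (cmod (g n x))\<bar> * cmod (g n x)) \<le> 1 * B"
      by (intro mult_mono) auto
    then show ?thesis by (simp add: k_def norm_mult abs_mult mult.assoc norm_divide)
  qed
  have k0: "k n x = 0" if "R + 1 < \<bar>x\<bar>" for n x
    using that by (simp add: k_def c_def)
  have kb: "bcs (k n)" for n
    by (rule bcsI[where R="R+1" and B=B]) 
       (use kB k0 borel_measurable_continuous_onI[OF kc] in auto)
  have ch: "complex_of_real (c x) * h x = h x" for x
    using h(4)[of x] by (cases "\<bar>x\<bar> \<le> R") (auto simp: c_def)
  have klim: "(\<lambda>n. k n x) \<longlonglongrightarrow> h x" if "x \<notin> N" for x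
  proof -
    have "(\<lambda>n. k n x) \<longlonglongrightarrow> complex_of_real (c x * (B / max B (cmod (h x)))) * h x"
      unfolding k_def using h(1) by (intro tendsto_intros lim that) auto
    moreover have "max B (cmod (h x)) = B" using h(3)[of x] by auto
    ultimately show ?thesis using h(1) ch[of x] by simp
  qed
  have "(\<lambda>n. LINT x|lborel. cmod (k n x - h x)) \<longlonglongrightarrow> (LINT x::real|lborel. (0::real))"
  proof (rule integral_dominated_convergence[where w="\<lambda>x. indicator {-R-1..R+1} x * (2*B)"])
    have "N \<in> null_sets lebesgue" using N negligible_iff_null_sets by blast
    then have "AE x in lborel. x \<notin> N"
      using AE_not_in AE_completion_iff by blast
    then show "AE x in lborel. (\<lambda>n. cmod (k n x - h x)) \<longlonglongrightarrow> 0"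
    proof eventually_elim
      case (elim x)
      from tendsto_diff[OF klim[OF elim] tendsto_const[of "h x"]] show ?case
        by (simp add: tendsto_norm_zero)
    qed
    show "AE x in lborel. norm (cmod (k n x - h x)) \<le> indicator {-R-1..R+1} x * (2*B)" for n
    proof (rule AE_I2)
      fix x
      show "norm (cmod (k n x - h x)) \<le> indicator {-R-1..R+1} x * (2*B)"
        using norm_triangle_ineq4[of "k n x" "h x"] kB[of n x] h(3)[of x] k0[of x n] h(4)[of x]
        by (cases "\<bar>x\<bar> \<le> R + 1") (auto simp: indicator_def abs_if split: if_splits)
    qed
    show "(\<lambda>x. cmod (k n x - h x)) \<in> borel_measurable lborel" for n
      using bcs_measurable[OF kb[of n]] by measurable
    show "integrable lborel (\<lambda>x. indicator {-R-1..R+1} x * (2*B))"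
      by (intro integrable_mult_left integrable_real_indicator) (auto simp: emeasure_lborel_Icc_eq)
  qed simp
  then have "eventually (\<lambda>n. (LINT x|lborel. cmod (k n x - h x)) < e) sequentially"
    using assms(2) by (auto dest: order_tendstoD(2))
  then obtain n where "(LINT x|lborel. cmod (k n x - h x)) < e"
    by (auto simp: eventually_sequentially)
  then show ?thesis using that[of "k n"] kc kb by auto
qed

text \<open>The shifts \<open>s n\<close> are bounded by some M, so all supports lie in
  [-R - M, R + M], where pointwise continuity and dominated convergence apply.\<close>

lemma continuous_bcs_L1_translation:
  assumes "bcs g" "continuous_on UNIV g" "s \<longlonglongrightarrow> 0"
  shows "(\<lambda>n. LINT x|lborel. cmod (g (x + s n) - g x)) \<longlonglongrightarrow> 0"
proof -
  obtain B R where h: "B > 0" "R > 0" "\<And>x. cmod (g x) \<le> B" "\<And>x. R < \<bar>x\<bar> \<Longrightarrow> g x = 0"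
    using bcsE[OF assms(1)] by blast
  have gm[measurable]: "g \<in> borel_measurable borel" by (rule bcs_measurable[OF assms(1)])
  obtain M where M: "M > 0" "\<And>n. \<bar>s n\<bar> \<le> M"
    using convergent_imp_Bseq[of s] assms(3) unfolding Bseq_def convergent_def by auto
  have "(\<lambda>n. LINT x|lborel. cmod (g (x + s n) - g x)) \<longlonglongrightarrow> (LINT x::real|lborel. (0::real))"
  proof (rule integral_dominated_convergence[where w="\<lambda>x. indicator {-R-M..R+M} x * (2*B)"])
    show "AE x in lborel. (\<lambda>n. cmod (g (x + s n) - g x)) \<longlonglongrightarrow> 0"
    proof (rule AE_I2)
      fix x
      have "isCont g x" using assms(2) by (simp add: continuous_on_eq_continuous_at)
      moreover have "(\<lambda>n. x + s n) \<longlonglongrightarrow> x" using tendsto_add[OF tendsto_const[of x] assms(3)] by simp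
      ultimately have "(\<lambda>n. g (x + s n)) \<longlonglongrightarrow> g x" by (rule isCont_tendsto_compose)
      from tendsto_diff[OF this tendsto_const[of "g x"]] 
      show "(\<lambda>n. cmod (g (x + s n) - g x)) \<longlonglongrightarrow> 0" by (simp add: tendsto_norm_zero)
    qed
    show "AE x in lborel. norm (cmod (g (x + s n) - g x)) \<le> indicator {-R-M..R+M} x * (2*B)" for n
    proof (rule AE_I2)
      fix x
      show "norm (cmod (g (x + s n) - g x)) \<le> indicator {-R-M..R+M} x * (2*B)"
      proof (cases "\<bar>x\<bar> \<le> R + M")
        case True
        then show ?thesis
          using norm_triangle_ineq4[of "g (x + s n)" "g x"] h(3)[of x] h(3)[of "x + s n"] 
          by (auto simp: indicator_def abs_if split: if_splits)
      next
        case False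
        then have "R < \<bar>x\<bar>" "R < \<bar>x + s n\<bar>" using M(1) M(2)[of n] by linarith+
        then show ?thesis using h(1) h(4) by auto
      qed
    qed
    show "(\<lambda>x. cmod (g (x + s n) - g x)) \<in> borel_measurable lborel" for n
      by measurable
    show "integrable lborel (\<lambda>x. indicator {-R-M..R+M} x * (2*B))"
      by (intro integrable_mult_left integrable_real_indicator) (auto simp: emeasure_lborel_Icc_eq)
  qed simp
  then show ?thesis by simp
qed

lemma integral_translate:
  fixes f :: "real \<Rightarrow> 'a :: {banach, second_countable_topology}"
  shows "(LINT x|lborel. f (x + s)) = (LINT x|lborel. f x)"
  using lborel_integral_real_affine[of 1 f s] by (simp add: add.commute)

lemma integrable_translate:
  fixes f :: "real \<Rightarrow> 'a :: {banach, second_countable_topology}"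
  shows "integrable lborel f \<Longrightarrow> integrable lborel (\<lambda>x. f (x + s))"
  using lborel_integrable_real_affine[of f 1 s] by (simp add: add.commute)

lemma bcs_translate: "bcs h \<Longrightarrow> bcs (\<lambda>x. h (x + s))"
  using bcs_affine[of h 1 s] by (simp add: add.commute)

text \<open>A three-term estimate through a continuous \<open>g\<close> close to \<open>h\<close>:
  by translation invariance the error made on the shifted functions equals the one made on the
  unshifted functions.\<close>

lemma bcs_L1_translation:
  assumes "bcs h" "s \<longlonglongrightarrow> 0"
  shows "(\<lambda>n. LINT x|lborel. cmod (h (x + s n) - h x)) \<longlonglongrightarrow> 0"
proof (rule metric_LIMSEQ_I)
  fix e :: real assume e: "e > 0"
  obtain g where g: "continuous_on UNIV g" "bcs g" "(LINT x|lborel. cmod (g x - h x)) < e/3"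
    using bcs_L1_approx_continuous[OF assms(1), of "e/3"] e by auto
  have "eventually (\<lambda>n. (LINT x|lborel. cmod (g (x + s n) - g x)) < e/3) sequentially"
    using order_tendstoD(2)[OF continuous_bcs_L1_translation[OF g(2,1) assms(2)], of "e/3"] e by auto
  then have "eventually (\<lambda>n. dist (LINT x|lborel. cmod (h (x + s n) - h x)) 0 < e) sequentially"
  proof eventually_elim
    case (elim n)
    note i = integrable_norm[OF bcs_integrable[OF bcs_diff[OF g(2) assms(1)]]]
    note i3 = integrable_norm[OF bcs_integrable[OF bcs_diff[OF bcs_translate[OF g(2), of "s n"] g(2)]]]
    note i2 = integrable_translate[OF i, of "s n"]
    have "(LINT x|lborel. cmod (h (x + s n) - h x)) \<le>
      (LINT x|lborel. cmod (g (x + s n) - h (x + s n)) + cmod (g (x + s n) - g x) + cmod (g x - h x))"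
    proof (rule integral_mono)
      show "integrable lborel (\<lambda>x. cmod (h (x + s n) - h x))"
        by (intro integrable_norm bcs_integrable bcs_diff bcs_translate assms)
      show "integrable lborel (\<lambda>x. cmod (g (x + s n) - h (x + s n)) + cmod (g (x + s n) - g x) + cmod (g x - h x))"
        by (intro Bochner_Integration.integrable_add i i2 i3)
      fix x
      show "cmod (h (x + s n) - h x) \<le> cmod (g (x + s n) - h (x + s n)) + cmod (g (x + s n) - g x) + cmod (g x - h x)"
        by norm
    qed
    also have "\<dots> = (LINT x|lborel. cmod (g (x + s n) - h (x + s n))) + 
        (LINT x|lborel. cmod (g (x + s n) - g x)) + (LINT x|lborel. cmod (g x - h x))"
      by (simp add: i i2 i3)
    also have "(LINT x|lborel. cmod (g (x + s n) - h (x + s n))) = (LINT x|lborel. cmod (g x - h x))"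
      by (rule integral_translate)
    finally have "(LINT x|lborel. cmod (h (x + s n) - h x)) < e" using g(3) elim by linarith
    moreover have "0 \<le> (LINT x|lborel. cmod (h (x + s n) - h x))" by simp
    ultimately show ?case by (simp add: dist_real_def)
  qed
  then show "\<exists>no. \<forall>n\<ge>no. dist (LINT x|lborel. cmod (h (x + s n) - h x)) 0 < e"
    by (auto simp: eventually_sequentially)
qed

section \<open>The Riemann-Lebesgue lemma and Plancherel's theorem\<close>

definition ft :: "real \<Rightarrow> (real \<Rightarrow> complex) \<Rightarrow> real \<Rightarrow> complex" where
  "ft a h t = (LINT x|lborel. cis (a * x * t) * h x)"

lemma borel_measurable_ft: 
  assumes [measurable]: "h \<in> borel_measurable borel" shows "ft a h \<in> borel_measurable borel"
  unfolding ft_def by measurable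

lemma cmod_ft_le: "bcs h \<Longrightarrow> cmod (ft a h t) \<le> (LINT x|lborel. cmod (h x))"
  unfolding ft_def
  by (rule order_trans[OF integral_norm_bound]) (simp add: norm_mult)

lemma ft_modulate: 
  assumes "a \<noteq> 0"
  shows "ft a (\<lambda>x. cis (w * x) * h x) t = ft a h (t + w / a)"
proof -
  have "cis (a * x * t) * (cis (w * x) * h x) = cis (a * x * (t + w / a)) * h x" for x
  proof -
    have "a * x * (t + w / a) = a * x * t + w * x" using assms by (simp add: field_simps)
    then show ?thesis by (simp add: cis_mult flip: mult.assoc)
  qed
  then show ?thesis unfolding ft_def by (simp only:)
qed

text \<open>Translating by half a period of the kernel changes its sign.\<close>

lemma cmod_ft_translation_le:
  assumes "bcs h" "a \<noteq> 0" "t \<noteq> 0"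
  shows "2 * cmod (ft a h t) \<le> (LINT x|lborel. cmod (h (x + pi / (a * t)) - h x))"
proof -
  let ?s = "pi / (a * t)"
  have "ft a h t = (LINT x|lborel. cis (a * (x + ?s) * t) * h (x + ?s))"
    unfolding ft_def by (rule integral_translate[symmetric])
  also have "\<dots> = (LINT x|lborel. - (cis (a * x * t) * h (x + ?s)))"
  proof (rule Bochner_Integration.integral_cong[OF refl])
    fix x
    have "a * (x + ?s) * t = a * x * t + pi" using assms by (simp add: field_simps)
    then show "cis (a * (x + ?s) * t) * h (x + ?s) = - (cis (a * x * t) * h (x + ?s))"
      by (simp add: cis_mult[symmetric])
  qed
  finally have "2 * ft a h t = (LINT x|lborel. cis (a * x * t) * h x) - (LINT x|lborel. cis (a * x * t) * h (x + ?s))"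
    by (simp add: ft_def)
  also have "\<dots> = (LINT x|lborel. cis (a * x * t) * h x - cis (a * x * t) * h (x + ?s))"
    by (rule Bochner_Integration.integral_diff[symmetric])
       (auto intro!: bcs_integrable bcs_cis_mult bcs_translate assms)
  finally have "cmod (2 * ft a h t) \<le> (LINT x|lborel. cmod (cis (a * x * t) * h x - cis (a * x * t) * h (x + ?s)))"
    by (simp only: integral_norm_bound)
  also have "\<dots> = (LINT x|lborel. cmod (h (x + ?s) - h x))"
    by (simp only: right_diff_distrib[symmetric] norm_mult norm_cis mult_1 norm_minus_commute)
  finally show ?thesis by (simp add: norm_mult)
qed

text \<open>As |t| grows the half-period pi / (a t) tends to 0, so continuity of translation in L^1
  makes the bound by the shifted difference small.\<close>

lemma riemann_lebesgue:
  assumes "bcs h" "a \<noteq> 0" "e > 0"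
  obtains M where "\<And>t. M \<le> \<bar>t\<bar> \<Longrightarrow> cmod (ft a h t) < e"
proof (rule ccontr)
  assume "\<not> thesis"
  \<comment> \<open>The \<open>+ 1\<close> makes every \<open>t n\<close> nonzero, also for n = 0,
    so that \<open>pi / (a * t n)\<close> is a genuine half-period.\<close>
  with that have "\<forall>n::nat. \<exists>t. real n + 1 \<le> \<bar>t\<bar> \<and> e \<le> cmod (ft a h t)"
    by (meson not_less)
  then obtain t where t: "\<And>n::nat. real n + 1 \<le> \<bar>t n\<bar>" "\<And>n. e \<le> cmod (ft a h (t n))" by metis
  have "filterlim (\<lambda>n. \<bar>t n\<bar>) at_top sequentially"
  proof (rule filterlim_at_top_mono[OF filterlim_real_sequentially], rule always_eventually, rule allI)
    show "real n \<le> \<bar>t n\<bar>" for n using t(1)[of n] by linarith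
  qed
  then have "filterlim t at_infinity sequentially"
    by (simp add: filterlim_at_infinity_conv_norm_at_top)
  then have "(\<lambda>n. (pi / a) / t n) \<longlonglongrightarrow> 0"
    by (rule tendsto_divide_0[OF tendsto_const])
  then have "(\<lambda>n. LINT x|lborel. cmod (h (x + pi / (a * t n)) - h x)) \<longlonglongrightarrow> 0"
    using bcs_L1_translation[OF assms(1), of "\<lambda>n. pi / (a * t n)"] by simp
  moreover have "2 * e \<le> (LINT x|lborel. cmod (h (x + pi / (a * t n)) - h x))" for n
  proof -
    have "t n \<noteq> 0" using t(1)[of n] by auto
    from cmod_ft_translation_le[OF assms(1,2) this] t(2)[of n] show ?thesis by linarith
  qed
  ultimately have "2 * e \<le> 0" by (intro LIMSEQ_le_const) auto
  with assms(3) show False by simp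
qed

section \<open>Plancherel's theorem via the autocorrelation\<close>

lemma Fubini_bcs_bounded:
  fixes F :: "real \<Rightarrow> real \<Rightarrow> complex"
  assumes "case_prod F \<in> borel_measurable (lborel \<Otimes>\<^sub>M lborel)"
    and "\<And>x y. cmod (F x y) \<le> B" "\<And>x y. R < \<bar>x\<bar> \<or> R < \<bar>y\<bar> \<Longrightarrow> F x y = 0"
  shows "(LINT y|lborel. LINT x|lborel. F x y) = (LINT x|lborel. LINT y|lborel. F x y)"
proof (rule lborel_pair.Fubini_integral)
  show "integrable (lborel \<Otimes>\<^sub>M lborel) (case_prod F)"
  proof (rule integrableI_bounded_set[where A="{-R..R} \<times> {-R..R}" and B=B])
    show "emeasure (lborel \<Otimes>\<^sub>M lborel) ({-R..R} \<times> {-R..R}) < \<infinity>"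
      by (subst lborel.emeasure_pair_measure_Times)
         (auto simp: emeasure_lborel_Icc_eq ennreal_mult_less_top)
    show "AE x in lborel \<Otimes>\<^sub>M lborel. x \<in> {- R..R} \<times> {- R..R} \<longrightarrow> cmod (case x of (x, xa) \<Rightarrow> F x xa) \<le> B"
      using assms(2) by auto
    show "AE x in lborel \<Otimes>\<^sub>M lborel. x \<notin> {- R..R} \<times> {- R..R} \<longrightarrow> (case x of (x, xa) \<Rightarrow> F x xa) = 0"
    proof (intro AE_I2 impI)
      fix p :: "real \<times> real" assume "p \<notin> {- R..R} \<times> {- R..R}"
      then have "R < \<bar>fst p\<bar> \<or> R < \<bar>snd p\<bar>" by (cases p) (auto simp: abs_if)
      from assms(3)[OF this] show "(case p of (x, xa) \<Rightarrow> F x xa) = 0" by (simp add: split_beta)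
    qed
  qed (use assms(1) in auto)
qed

text \<open>The convolution of \<open>h\<close> with its reflected conjugate. Passing to it turns
  the quadratic quantity in Plancherel's theorem into a linear one.\<close>

definition autocorr :: "(real \<Rightarrow> complex) \<Rightarrow> real \<Rightarrow> complex" where
  "autocorr h s = (LINT y|lborel. h (s + y) * cnj (h y))"

lemma bcs_mult_bcs:
  assumes "bcs g" "bcs h" shows "bcs (\<lambda>x. g x * h x)"
proof -
  obtain B where B: "\<And>x. cmod (g x) \<le> B" by (rule bcsE[OF assms(1)]) (rule that)
  show ?thesis
    by (rule bcs_mult[OF assms(2) bcs_measurable[OF assms(1)]]) (rule exI[of _ B], simp add: B)
qed

lemma bcs_autocorr:
  assumes "bcs h" shows "bcs (autocorr h)"
proof -
  obtain B R where h: "B > 0" "R > 0" "\<And>x. cmod (h x) \<le> B" "\<And>x. R < \<bar>x\<bar> \<Longrightarrow> h x = 0"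
    using bcsE[OF assms(1)] by blast
  have [measurable]: "h \<in> borel_measurable borel" by (rule bcs_measurable[OF assms])
  show ?thesis
  proof (rule bcsI[where R="2*R" and B="LINT y|lborel. B * cmod (h y)"])
    show "autocorr h \<in> borel_measurable borel" unfolding autocorr_def by measurable
    show "cmod (autocorr h s) \<le> (LINT y|lborel. B * cmod (h y))" for s
      unfolding autocorr_def
    proof (rule order_trans[OF integral_norm_bound integral_mono])
      have "bcs (\<lambda>y. h (y + s) * cnj (h y))"
        by (rule bcs_mult_bcs[OF bcs_translate[OF assms] bcs_cnj[OF assms]])
      then show "integrable lborel (\<lambda>y. cmod (h (s + y) * cnj (h y)))"
        by (intro integrable_norm bcs_integrable) (simp add: add.commute)
      show "integrable lborel (\<lambda>y. B * cmod (h y))"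
        by (intro integrable_mult_right integrable_norm bcs_integrable assms)
      show "cmod (h (s + y) * cnj (h y)) \<le> B * cmod (h y)" for y
        using h(3)[of "s + y"] by (simp add: norm_mult mult_right_mono)
    qed
    show "autocorr h s = 0" if "2 * R < \<bar>s\<bar>" for s
    proof -
      have "h (s + y) * cnj (h y) = 0" for y
      proof (cases "\<bar>y\<bar> \<le> R")
        case True
        then have "R < \<bar>s + y\<bar>" using that by linarith
        then show ?thesis using h(4) by simp
      qed (use h(4) in auto)
      then show ?thesis unfolding autocorr_def by (simp only: Bochner_Integration.integral_zero)
    qed
  qed
qed

lemma autocorr_0: "autocorr h 0 = complex_of_real (LINT x|lborel. (cmod (h x))\<^sup>2)"
  unfolding autocorr_def by (simp only: add_0 cmod_mult_cnj_real integral_complex_of_real)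

text \<open>The difference pairs \<open>h (y + s n) - h y\<close>, small in L^1, with the bounded
  function \<open>cnj (h y)\<close>. Continuity at 0 is what lets Gaussian averages recover the
  value there.\<close>

lemma autocorr_tendsto:
  assumes "bcs h" "s \<longlonglongrightarrow> 0" shows "(\<lambda>n. autocorr h (s n)) \<longlonglongrightarrow> autocorr h 0"
proof -
  obtain B R where h: "B > 0" "R > 0" "\<And>x. cmod (h x) \<le> B" "\<And>x. R < \<bar>x\<bar> \<Longrightarrow> h x = 0"
    using bcsE[OF assms(1)] by blast
  have i: "integrable lborel (\<lambda>y. h (y + s) * cnj (h y))" for s
    by (rule bcs_integrable[OF bcs_mult_bcs[OF bcs_translate[OF assms(1)] bcs_cnj[OF assms(1)]]])
  have bound: "cmod (autocorr h (s n) - autocorr h 0) \<le> B * (LINT x|lborel. cmod (h (x + s n) - h x))" for n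
  proof -
    have i0: "integrable lborel (\<lambda>y. h y * cnj (h y))"
      by (rule bcs_integrable[OF bcs_mult_bcs[OF assms(1) bcs_cnj[OF assms(1)]]])
    have "autocorr h (s n) - autocorr h 0 = (LINT y|lborel. (h (y + s n) - h y) * cnj (h y))"
      unfolding autocorr_def left_diff_distrib add_0 add.commute[of "s n"]
      by (rule Bochner_Integration.integral_diff[OF i i0, symmetric])
    also have "cmod \<dots> \<le> (LINT y|lborel. B * cmod (h (y + s n) - h y))"
    proof (rule order_trans[OF integral_norm_bound integral_mono])
      show "integrable lborel (\<lambda>y. cmod ((h (y + s n) - h y) * cnj (h y)))"
        unfolding left_diff_distrib by (intro integrable_norm Bochner_Integration.integrable_diff i i0)
      show "integrable lborel (\<lambda>y. B * cmod (h (y + s n) - h y))"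
        by (rule integrable_mult_right[OF integrable_norm[OF bcs_integrable[OF bcs_diff[OF bcs_translate[OF assms(1)] assms(1)]]]])
      show "cmod ((h (y + s n) - h y) * cnj (h y)) \<le> B * cmod (h (y + s n) - h y)" for y
        using mult_right_mono[OF h(3)[of y] norm_ge_zero[of "h (y + s n) - h y"]] by (simp add: norm_mult mult.commute)
    qed
    finally show ?thesis by simp
  qed
  have "(\<lambda>n. autocorr h (s n) - autocorr h 0) \<longlonglongrightarrow> 0"
    by (rule Lim_null_comparison[OF always_eventually[OF allI[OF bound]] 
        tendsto_mult_right_zero[OF bcs_L1_translation[OF assms]]])
  then show ?thesis by (rule LIM_zero_cancel)
qed

text \<open>In the square written as a double integral, the substitution x = s + y cancels the phase
  in \<open>y\<close>; Fubini then integrates over \<open>y\<close> first.\<close>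

lemma cmod_ft_power2:
  assumes "bcs h" 
  shows "complex_of_real ((cmod (ft a h t))\<^sup>2) = ft a (autocorr h) t"
proof -
  obtain B R where h: "B > 0" "R > 0" "\<And>x. cmod (h x) \<le> B" "\<And>x. R < \<bar>x\<bar> \<Longrightarrow> h x = 0"
    using bcsE[OF assms(1)] by blast
  have [measurable]: "h \<in> borel_measurable borel" by (rule bcs_measurable[OF assms])
  have "complex_of_real ((cmod (ft a h t))\<^sup>2) = ft a h t * cnj (ft a h t)"
    by (simp only: cmod_mult_cnj_real)
  also have "\<dots> = ft a h t * (LINT y|lborel. cnj (cis (a * y * t) * h y))"
    unfolding ft_def by (simp only: Bochner_Integration.integral_cnj)
  also have "\<dots> = (LINT y|lborel. ft a h t * cnj (cis (a * y * t) * h y))"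
    by simp
  also have "\<dots> = (LINT y|lborel. LINT s|lborel. cis (a * s * t) * (h (s + y) * cnj (h y)))"
  proof (rule Bochner_Integration.integral_cong[OF refl])
    fix y
    have "ft a h t = (LINT s|lborel. cis (a * (s + y) * t) * h (s + y))"
      unfolding ft_def by (rule integral_translate[symmetric])
    then have "ft a h t * cnj (cis (a * y * t) * h y) = 
       (LINT s|lborel. cis (a * (s + y) * t) * h (s + y) * cnj (cis (a * y * t) * h y))"
      by simp
    also have "\<dots> = (LINT s|lborel. cis (a * s * t) * (h (s + y) * cnj (h y)))"
    proof (rule Bochner_Integration.integral_cong[OF refl])
      fix s
      have *: "cis (a * (s + y) * t) * cnj (cis (a * y * t)) = cis (a * s * t)"
        by (simp add: cis_cnj cis_mult algebra_simps)
      show "cis (a * (s + y) * t) * h (s + y) * cnj (cis (a * y * t) * h y) = cis (a * s * t) * (h (s + y) * cnj (h y))"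
        unfolding *[symmetric] complex_cnj_mult by (simp only: mult_ac)
    qed
    finally show "ft a h t * cnj (cis (a * y * t) * h y) = (LINT s|lborel. cis (a * s * t) * (h (s + y) * cnj (h y)))" .
  qed
  also have "\<dots> = (LINT s|lborel. LINT y|lborel. cis (a * s * t) * (h (s + y) * cnj (h y)))"
  proof (rule Fubini_bcs_bounded[where B="B*B" and R="2*R"])
    show "cmod (cis (a * s * t) * (h (s + y) * cnj (h y))) \<le> B * B" for s y
      using mult_mono[OF h(3)[of "s + y"] h(3)[of y]] h(1) by (simp add: norm_mult)
    \<comment> \<open>Why the window is 2 R: either |y| > R and \<open>h y\<close> vanishes, or |y|
      \<le> R, which forces |s| > 2 R and hence |s + y| > R.\<close>
    show "cis (a * s * t) * (h (s + y) * cnj (h y)) = 0" if "2 * R < \<bar>s\<bar> \<or> 2 * R < \<bar>y\<bar>" for s y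
    proof (cases "\<bar>y\<bar> \<le> R")
      case True
      then have "R < \<bar>s + y\<bar>" using that h(2) by linarith
      then show ?thesis using h(4) by simp
    qed (use h(4) in auto)
    show "(\<lambda>(s, y). cis (a * s * t) * (h (s + y) * cnj (h y))) \<in> borel_measurable (lborel \<Otimes>\<^sub>M lborel)"
      by measurable
  qed
  also have "\<dots> = ft a (autocorr h) t"
    unfolding ft_def autocorr_def by simp
  finally show ?thesis .
qed

lemma integral_cis_std_normal: 
  "(LINT x|lborel. cis (u * x) * complex_of_real (std_normal_density x)) = complex_of_real (exp (- u\<^sup>2 / 2))"
proof -
  have "complex_of_real (exp (- u\<^sup>2 / 2)) = char std_normal_distribution u"
    by (simp add: char_std_normal_distribution)
  also have "\<dots> = (LINT x|lborel. std_normal_density x *\<^sub>R iexp (u * x))"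
    unfolding char_def by (subst integral_density) (auto simp: std_normal_density_def)
  also have "\<dots> = (LINT x|lborel. cis (u * x) * complex_of_real (std_normal_density x))"
    by (simp add: cis_conv_exp scaleR_conv_of_real mult.commute)
  finally show ?thesis ..
qed

text \<open>Fubini moves the transform from \<open>r\<close> onto the Gaussian, whose transform is
  again Gaussian. As \<sigma> tends to 0, the weight on the left flattens to 1 / sqrt (2 pi) while
  the right side samples \<open>r\<close> ever closer to 0. The constant collects the Jacobian
  \<sigma> / |a| of s = \<sigma> w / a, the factor 1 / \<sigma> of the inner integral and the
  normalization of the density.\<close>

lemma integral_ft_gaussian:
  assumes "bcs r" "a \<noteq> 0" "\<sigma> > 0"
  shows "integrable lborel (\<lambda>t. ft a r t * complex_of_real (std_normal_density (\<sigma> * t)))" (is ?A)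
    and "(LINT t|lborel. ft a r t * complex_of_real (std_normal_density (\<sigma> * t))) =
      complex_of_real (sqrt (2 * pi) / \<bar>a\<bar>) * (LINT w|lborel. r (\<sigma> / a * w) * complex_of_real (std_normal_density w))" (is ?B)
proof -
  have [measurable]: "r \<in> borel_measurable borel" by (rule bcs_measurable[OF assms(1)])
  have ni: "integrable lborel (\<lambda>t. std_normal_density (\<sigma> * t))"
    using lborel_integrable_real_affine[of std_normal_density \<sigma> 0] assms(3) integrable_std_normal_moment[of 0] by simp
  let ?F = "\<lambda>s t. cis (a * s * t) * r s * complex_of_real (std_normal_density (\<sigma> * t))"
  have Fi: "integrable (lborel \<Otimes>\<^sub>M lborel) (case_prod ?F)"
  proof (rule lborel_pair.Fubini_integrable)
    show "case_prod ?F \<in> borel_measurable (lborel \<Otimes>\<^sub>M lborel)" by measurable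
    show "integrable lborel (\<lambda>x. LINT y|lborel. norm (case (x, y) of (s, t) \<Rightarrow> ?F s t))"
      by (simp add: norm_mult) (intro disjI2 integrable_norm bcs_integrable assms)
    show "AE x in lborel. integrable lborel (\<lambda>y. case (x, y) of (s, t) \<Rightarrow> ?F s t)"
    proof (rule AE_I2)
      fix s :: real
      have "integrable lborel (\<lambda>t. r s * complex_of_real (std_normal_density (\<sigma> * t)))"
        using ni by simp
      then show "integrable lborel (\<lambda>y. case (s, y) of (s, t) \<Rightarrow> ?F s t)"
        by (rule Bochner_Integration.integrable_bound) (auto simp: norm_mult)
    qed
  qed
  have eq: "ft a r t * complex_of_real (std_normal_density (\<sigma> * t)) = (LINT s|lborel. ?F s t)" for t
    by (simp add: ft_def)
  show ?A unfolding eq using lborel_pair.integrable_snd[OF Fi] by simp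
  have in_t: "(LINT t|lborel. ?F s t) = r s * complex_of_real (exp (- (a * s / \<sigma>)\<^sup>2 / 2) / \<sigma>)" for s
  proof -
    have "(LINT t|lborel. cis (a * s * t) * complex_of_real (std_normal_density (\<sigma> * t))) =
       \<bar>1/\<sigma>\<bar> *\<^sub>R (LINT t|lborel. cis (a * s * (0 + 1/\<sigma> * t)) * complex_of_real (std_normal_density (\<sigma> * (0 + 1/\<sigma> * t))))"
      by (rule lborel_integral_real_affine) (use assms in auto)
    also have "\<dots> = (1/\<sigma>) *\<^sub>R (LINT t|lborel. cis ((a * s / \<sigma>) * t) * complex_of_real (std_normal_density t))"
      using assms(3) by simp
    also have "\<dots> = complex_of_real (exp (- (a * s / \<sigma>)\<^sup>2 / 2) / \<sigma>)"
      unfolding integral_cis_std_normal by (simp add: scaleR_conv_of_real)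
    finally have *: "(LINT t|lborel. cis (a * s * t) * complex_of_real (std_normal_density (\<sigma> * t))) = complex_of_real (exp (- (a * s / \<sigma>)\<^sup>2 / 2) / \<sigma>)" .
    have "(LINT t|lborel. ?F s t) = (LINT t|lborel. r s * (cis (a * s * t) * complex_of_real (std_normal_density (\<sigma> * t))))"
      by (simp add: mult_ac)
    then show ?thesis by (simp only: integral_mult_right_zero *)
  qed
  have "(LINT t|lborel. ft a r t * complex_of_real (std_normal_density (\<sigma> * t))) = (LINT s|lborel. LINT t|lborel. ?F s t)"
    unfolding eq by (rule lborel_pair.Fubini_integral[OF Fi])
  also have "\<dots> = (LINT s|lborel. r s * complex_of_real (exp (- (a * s / \<sigma>)\<^sup>2 / 2) / \<sigma>))"
    unfolding in_t ..
  also have "\<dots> = \<bar>\<sigma> / a\<bar> *\<^sub>R (LINT w|lborel. r (0 + \<sigma> / a * w) * complex_of_real (exp (- (a * (0 + \<sigma> / a * w) / \<sigma>)\<^sup>2 / 2) / \<sigma>))"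
    by (rule lborel_integral_real_affine) (use assms in auto)
  also have "\<dots> = \<bar>\<sigma> / a\<bar> *\<^sub>R (LINT w|lborel. complex_of_real (sqrt (2 * pi) / \<sigma>) * (r (\<sigma> / a * w) * complex_of_real (std_normal_density w)))"
    using assms by (simp add: std_normal_density_def mult_ac)
  also have "\<dots> = complex_of_real (sqrt (2 * pi) / \<bar>a\<bar>) * (LINT w|lborel. r (\<sigma> / a * w) * complex_of_real (std_normal_density w))"
    using assms by (simp only: integral_mult_right_zero) (simp add: scaleR_conv_of_real)
  finally show ?B .
qed

text \<open>$|\hat h|^2$ is the transform of the autocorrelation of $h$, whose value at $0$ is recovered by
  Gaussian summation.\<close>

lemma plancherel_ft:
  assumes "bcs h" "a \<noteq> 0"
  shows "integrable lborel (\<lambda>t. (cmod (ft a h t))\<^sup>2)"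
    and "(LINT t|lborel. (cmod (ft a h t))\<^sup>2) = 2 * pi / \<bar>a\<bar> * (LINT x|lborel. (cmod (h x))\<^sup>2)"
proof -
  let ?r = "autocorr h"
  note r = bcs_autocorr[OF assms(1)]
  have [measurable]: "?r \<in> borel_measurable borel" "ft a h \<in> borel_measurable borel" 
    using bcs_measurable[OF r] borel_measurable_ft[OF bcs_measurable[OF assms(1)]] by auto
  obtain B where B: "\<And>x. cmod (?r x) \<le> B" by (rule bcsE[OF r]) (rule that)
  \<comment> \<open>The scales decrease to 0, so that the weights
    \<open>std_normal_density (s n * t)\<close> increase with \<open>n\<close>.\<close>
  define s where "s n = 1 / (real n + 1)" for n
  have s: "s n > 0" "s \<longlonglongrightarrow> 0" for n
    unfolding s_def using LIMSEQ_inverse_real_of_nat by (auto simp: inverse_eq_divide add.commute)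
  define f where "f n t = (cmod (ft a h t))\<^sup>2 * std_normal_density (s n * t)" for n t
  have f_eq: "complex_of_real (f n t) = ft a ?r t * complex_of_real (std_normal_density (s n * t))" for n t
    unfolding f_def of_real_mult cmod_ft_power2[OF assms(1)] ..
  have fi: "integrable lborel (f n)" for n
    using integral_ft_gaussian(1)[OF r assms(2) s(1)[of n]] unfolding f_eq[symmetric] 
    by (simp add: complex_of_real_integrable_eq)
  define N where "N = (LINT x|lborel. (cmod (h x))\<^sup>2)"
  have "(\<lambda>n. LINT w|lborel. ?r (s n / a * w) * complex_of_real (std_normal_density w)) 
     \<longlonglongrightarrow> (LINT w|lborel. complex_of_real N * complex_of_real (std_normal_density w))"
  proof (rule integral_dominated_convergence[where w="\<lambda>w. B * std_normal_density w"])
    show "AE x in lborel. (\<lambda>n. ?r (s n / a * x) * complex_of_real (std_normal_density x)) \<longlonglongrightarrow> complex_of_real N * complex_of_real (std_normal_density x)"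
    proof (rule AE_I2)
      fix x
      have "(\<lambda>n. s n * (x / a)) \<longlonglongrightarrow> 0" by (rule tendsto_mult_left_zero[OF s(2)])
      then have "(\<lambda>n. s n / a * x) \<longlonglongrightarrow> 0" by (simp add: mult.commute)
      from autocorr_tendsto[OF assms(1) this]
      show "(\<lambda>n. ?r (s n / a * x) * complex_of_real (std_normal_density x)) \<longlonglongrightarrow> complex_of_real N * complex_of_real (std_normal_density x)"
        unfolding autocorr_0 N_def by (intro tendsto_mult tendsto_const)
    qed
    show "AE x in lborel. norm (?r (s n / a * x) * complex_of_real (std_normal_density x)) \<le> B * std_normal_density x" for n
      using B by (intro AE_I2) (auto simp: norm_mult mult_right_mono)
    show "integrable lborel (\<lambda>w. B * std_normal_density w)"
      using integrable_std_normal_moment[of 0] by simp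
  qed measurable
  also have "(LINT w|lborel. complex_of_real N * complex_of_real (std_normal_density w)) = complex_of_real N"
    using integral_std_normal_moment_even[of 0] by (simp add: integral_complex_of_real)
  finally have "(\<lambda>n. complex_of_real (sqrt (2 * pi) / \<bar>a\<bar>) * (LINT w|lborel. ?r (s n / a * w) * complex_of_real (std_normal_density w)))
     \<longlonglongrightarrow> complex_of_real (sqrt (2 * pi) / \<bar>a\<bar>) * complex_of_real N"
    by (intro tendsto_intros)
  then have "(\<lambda>n. complex_of_real (integral\<^sup>L lborel (f n))) \<longlonglongrightarrow> complex_of_real (sqrt (2 * pi) / \<bar>a\<bar> * N)"
    unfolding integral_ft_gaussian(2)[OF r assms(2) s(1), symmetric] f_eq[symmetric] integral_complex_of_real by simp
  then have lim: "(\<lambda>n. integral\<^sup>L lborel (f n)) \<longlonglongrightarrow> sqrt (2 * pi) / \<bar>a\<bar> * N"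
    by (simp only: tendsto_of_real_iff)
  \<comment> \<open>Integrability of the squared transform is itself to be shown, so the limit is
    taken by monotone convergence, which yields it together with the value; the limit of the
    integrals is already known from the autocorrelation side.\<close>
  have mono: "mono (\<lambda>n. f n t)" for t
  proof (rule monoI)
    fix m n :: nat assume "m \<le> n"
    then have "s n \<le> s m" by (simp add: s_def frac_le)
    then have "(s n * t)\<^sup>2 \<le> (s m * t)\<^sup>2"
      using s(1)[of n] by (simp add: power_mult_distrib mult_right_mono power_mono)
    then show "f m t \<le> f n t"
      unfolding f_def std_normal_density_def by (intro mult_left_mono) auto
  qed
  have flim: "(\<lambda>n. f n t) \<longlonglongrightarrow> (cmod (ft a h t))\<^sup>2 * (1 / sqrt (2 * pi))" for t
  proof -
    have "(\<lambda>n. s n * t) \<longlonglongrightarrow> 0" by (rule tendsto_mult_left_zero[OF s(2)])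
    then have "(\<lambda>n. (cmod (ft a h t))\<^sup>2 * (1 / sqrt (2 * pi) * exp (- (s n * t)\<^sup>2 / 2))) \<longlonglongrightarrow> (cmod (ft a h t))\<^sup>2 * (1 / sqrt (2 * pi) * exp (- 0\<^sup>2 / 2))"
      by (intro tendsto_intros) auto
    then show ?thesis unfolding f_def std_normal_density_def by simp
  qed
  note M = integral_monotone_convergence_nonneg[of lborel f, OF fi AE_I2[OF mono] AE_I2 AE_I2[OF flim] lim]
  have I: "integrable lborel (\<lambda>t. (cmod (ft a h t))\<^sup>2 * (1 / sqrt (2 * pi)))"
    by (rule M(1)) (auto simp: f_def)
  from integrable_mult_left[OF this, of "sqrt (2 * pi)"] 
  show "integrable lborel (\<lambda>t. (cmod (ft a h t))\<^sup>2)" by simp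
  have "(LINT t|lborel. (cmod (ft a h t))\<^sup>2 * (1 / sqrt (2 * pi))) = sqrt (2 * pi) / \<bar>a\<bar> * N"
    by (rule M(2)) (auto simp: f_def)
  then have "(LINT t|lborel. (cmod (ft a h t))\<^sup>2) / sqrt (2 * pi) = sqrt (2 * pi) / \<bar>a\<bar> * N"
    by simp
  then have "(LINT t|lborel. (cmod (ft a h t))\<^sup>2) = (sqrt (2 * pi) * sqrt (2 * pi)) / \<bar>a\<bar> * N"
    by (simp add: divide_eq_eq mult_ac del: real_sqrt_mult_self)
  then show "(LINT t|lborel. (cmod (ft a h t))\<^sup>2) = 2 * pi / \<bar>a\<bar> * (LINT x|lborel. (cmod (h x))\<^sup>2)"
    by (simp add: N_def)
qed

section \<open>The Fresnel integral\<close>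

lemma has_vector_derivative_cis [derivative_intros]:
  assumes "(f has_real_derivative f') (at x within S)"
  shows "((\<lambda>x. cis (f x)) has_vector_derivative (\<i> * complex_of_real f' * cis (f x))) (at x within S)"
proof -
  have "((\<lambda>x. \<i> * complex_of_real (f x)) has_vector_derivative (\<i> * complex_of_real f')) (at x within S)"
    using assms unfolding has_real_derivative_iff_has_vector_derivative
    by (intro has_vector_derivative_mult_right bounded_linear.has_vector_derivative[OF bounded_linear_of_real])
  from field_vector_diff_chain_within[OF this, of exp "exp (\<i> * complex_of_real (f x))"] 
  show ?thesis by (simp add: o_def cis_conv_exp DERIV_exp has_field_derivative_at_within mult_ac)
qed

text \<open>\<open>E\<close> is the Fresnel integral from 0 to t. It is kept abstract, as a
  primitive normalized at 0.\<close>

lemma fresnel_primitive: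
  obtains E where "E 0 = 0" "\<And>t. (E has_vector_derivative cis (t\<^sup>2)) (at t)"
proof -
  have "\<exists>F. \<forall>x::real. -\<infinity> < ereal x \<longrightarrow> ereal x < \<infinity> \<longrightarrow> (F has_vector_derivative cis (x\<^sup>2)) (at x)"
  proof (rule einterval_antiderivative)
    fix x :: real
    have "((\<lambda>x. cis (x\<^sup>2)) has_vector_derivative \<i> * complex_of_real (2 * x) * cis (x\<^sup>2)) (at x)"
      by (rule has_vector_derivative_cis) (auto intro!: derivative_eq_intros)
    then show "isCont (\<lambda>x. cis (x\<^sup>2)) x" by (rule has_vector_derivative_continuous)
  qed simp
  then obtain F where F: "\<And>t. (F has_vector_derivative cis (t\<^sup>2)) (at t)" by auto
  show ?thesis
  proof (rule that)
    show "((\<lambda>t. F t - F 0) has_vector_derivative cis (t\<^sup>2)) (at t)" for t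
      using has_vector_derivative_diff[OF F has_vector_derivative_const] by simp
  qed simp
qed

context
  fixes E :: "real \<Rightarrow> complex"
  assumes E0: "E 0 = 0" and E: "\<And>t. (E has_vector_derivative cis (t\<^sup>2)) (at t)"
begin

lemma fresnel_within: "(E has_vector_derivative cis (t\<^sup>2)) (at t within S)"
  using E by (rule has_vector_derivative_at_within)

lemma fresnel_continuous: "continuous_on S E"
  using E by (intro continuous_at_imp_continuous_on) (auto intro: has_vector_derivative_continuous)

lemma fresnel_scaled: "((\<lambda>s. E (r * s)) has_vector_derivative (complex_of_real r * cis ((r * s)\<^sup>2))) (at s within S)"
proof -
  have "((\<lambda>s. r * s) has_vector_derivative r) (at s within S)"
    by (auto intro!: derivative_eq_intros)
  from vector_diff_chain_within[OF this fresnel_within] show ?thesis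
    by (simp add: o_def scaleR_conv_of_real)
qed

lemma fresnel_odd: "E (- t) = - E t"
proof -
  have "((\<lambda>t. E t + E ((-1) * t)) has_vector_derivative 0) (at t)" for t
    by (rule derivative_eq_intros fresnel_within fresnel_scaled)+ simp
  then obtain c where "\<And>t. E t + E ((-1) * t) = c"
    using has_vector_derivative_zero_constant[of UNIV "\<lambda>t. E t + E ((-1) * t)"] by auto
  from this[of 0] this[of t] show ?thesis using E0 by (simp add: add_eq_0_iff)
qed

text \<open>The subtracted term comes from integrating $e^{it^2} = (2t e^{it^2})/(2t)$ by parts.\<close>

lemma fresnel_tail:
  assumes "1 \<le> s" "s \<le> t"
  shows "cmod ((E t - cis (t\<^sup>2) / (2 * \<i> * complex_of_real t)) - (E s - cis (s\<^sup>2) / (2 * \<i> * complex_of_real s))) \<le> 1 / (2 * s)"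
proof (cases "s = t")
  case False
  \<comment> \<open>The boundary term cancels the leading part of the derivative and leaves
    \<open>cis (x\<^sup>2) / (2 * \<i> * x\<^sup>2)\<close>, whose modulus is the derivative of
    \<open>- 1 / (2 * x)\<close>.\<close>
  let ?G = "\<lambda>t. E t - cis (t\<^sup>2) * complex_of_real (1 / t) / (2 * \<i>)"
  have G': "(?G has_vector_derivative (cis (x\<^sup>2) * complex_of_real (1 / x\<^sup>2) / (2 * \<i>))) (at x)" if "x > 0" for x
  proof -
    have "((\<lambda>x. 1 / x) has_real_derivative (- 1 / x\<^sup>2)) (at x)"
      using that by (auto intro!: derivative_eq_intros simp: power2_eq_square)
    then have 1: "((\<lambda>x. complex_of_real (1 / x)) has_vector_derivative complex_of_real (- 1 / x\<^sup>2)) (at x)"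
      unfolding has_real_derivative_iff_has_vector_derivative
      by (rule bounded_linear.has_vector_derivative[OF bounded_linear_of_real])
    have 2: "((\<lambda>x. x\<^sup>2) has_real_derivative (2 * x)) (at x)"
      by (auto intro!: derivative_eq_intros)
    have "(?G has_vector_derivative (cis (x\<^sup>2) - (cis (x\<^sup>2) * complex_of_real (- 1 / x\<^sup>2) + \<i> * complex_of_real (2 * x) * cis (x\<^sup>2) * complex_of_real (1 / x)) / (2 * \<i>))) (at x)"
      by (intro has_vector_derivative_diff E has_vector_derivative_divide has_vector_derivative_mult has_vector_derivative_cis 1 2)
    moreover have "cis (x\<^sup>2) - (cis (x\<^sup>2) * complex_of_real (- 1 / x\<^sup>2) + \<i> * complex_of_real (2 * x) * cis (x\<^sup>2) * complex_of_real (1 / x)) / (2 * \<i>) = cis (x\<^sup>2) * complex_of_real (1 / x\<^sup>2) / (2 * \<i>)"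
      using that by (simp add: field_simps)
    ultimately show ?thesis by simp
  qed
  have p': "((\<lambda>x. - 1 / (2 * x)) has_vector_derivative (1 / (2 * x\<^sup>2))) (at x)" if "x > 0" for x :: real
    unfolding has_real_derivative_iff_has_vector_derivative[symmetric]
    using that by (auto intro!: derivative_eq_intros simp: power2_eq_square field_simps)
  have "cmod (?G t - ?G s) \<le> - 1 / (2 * t) - (- 1 / (2 * s))"
  proof (rule differentiable_bound_general[where f=ff and f'="\<lambda>x. cis (x\<^sup>2) * complex_of_real (1 / x\<^sup>2) / (2 * \<i>)" and \<phi>'="\<lambda>x. 1 / (2 * x\<^sup>2)" for ff])
    show "s < t" using assms False by simp
    show "continuous_on {s..t} (\<lambda>x. - 1 / (2 * x))"
      using assms by (auto intro!: continuous_intros)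
    show "continuous_on {s..t} ?G"
      using assms by (intro continuous_at_imp_continuous_on ballI has_vector_derivative_continuous[OF G']) auto
    fix x assume x: "s < x" "x < t"
    then have "x > 0" using assms by auto
    then show "(?G has_vector_derivative (cis (x\<^sup>2) * complex_of_real (1 / x\<^sup>2) / (2 * \<i>))) (at x)" 
      by (rule G')
    show "((\<lambda>x. - 1 / (2 * x)) has_vector_derivative (1 / (2 * x\<^sup>2))) (at x)" 
      using \<open>x > 0\<close> by (rule p')
    show "cmod (cis (x\<^sup>2) * complex_of_real (1 / x\<^sup>2) / (2 * \<i>)) \<le> 1 / (2 * x\<^sup>2)"
      by (simp add: norm_mult norm_divide norm_power)
  qed
  also have "\<dots> \<le> 1 / (2 * s)" using assms by simp
  finally show ?thesis by (simp add: mult_ac)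
qed (use assms in auto)

text \<open>The corrected primitive \<open>G\<close> is Cauchy by the tail estimate and lies within
  1 / (2 t) of its limit; the correction has modulus 1 / (2 t) as well, and the two add up to the
  rate 1 / t.\<close>

lemma fresnel_limit_rate:
  obtains L where "\<And>t. 1 \<le> t \<Longrightarrow> cmod (E t - L) \<le> 1 / t"
proof -
  define G where "G t = E t - cis (t\<^sup>2) / (2 * \<i> * complex_of_real t)" for t
  have G: "cmod (G t - G s) \<le> 1 / (2 * s)" if "1 \<le> s" "s \<le> t" for s t
    unfolding G_def by (rule fresnel_tail[OF that])
  have "Cauchy (\<lambda>n::nat. G (real n))"
  proof (rule metric_CauchyI)
    fix e :: real assume e: "e > 0"
    obtain M :: nat where M: "M > 1 / e" "M \<ge> 1" by (metis reals_Archimedean2 max.strict_coboundedI1 max.cobounded2 of_nat_max less_le_trans le_refl max.commute linorder_not_le of_nat_less_iff order_le_less_trans)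
    have "dist (G (real m)) (G (real n)) < e" if "M \<le> m" "m \<le> n" for m n
    proof -
      have "cmod (G n - G m) \<le> 1 / (2 * real m)" using that M by (intro G) auto
      also have "\<dots> < e"
      proof -
        have "1 / e < real m" using that M by linarith
        then have "1 < e * real m" using e by (simp add: field_simps)
        then show ?thesis using that M e by (simp add: field_simps)
      qed
      finally show ?thesis by (simp add: dist_norm norm_minus_commute)
    qed
    then show "\<exists>M. \<forall>m\<ge>M. \<forall>n\<ge>M. dist (G (real m)) (G (real n)) < e"
      by (metis dist_commute nat_le_linear)
  qed
  then obtain L where L: "(\<lambda>n::nat. G (real n)) \<longlonglongrightarrow> L" using Cauchy_convergent_iff convergent_def by blast
  show ?thesis
  proof (rule that)
    fix t :: real assume t: "1 \<le> t"
    have "(\<lambda>n. cmod (G (real n) - G t)) \<longlonglongrightarrow> cmod (L - G t)"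
      by (intro tendsto_intros L)
    moreover have "eventually (\<lambda>n. cmod (G (real n) - G t) \<le> 1 / (2 * t)) sequentially"
      using eventually_ge_at_top[of "nat \<lceil>t\<rceil>"]
    proof eventually_elim
      case (elim n)
      then have "t \<le> real n" by linarith
      then show ?case by (rule G[OF t])
    qed
    ultimately have "cmod (L - G t) \<le> 1 / (2 * t)" by (rule tendsto_upperbound) simp
    moreover have "cmod (cis (t\<^sup>2) / (2 * \<i> * complex_of_real t)) = 1 / (2 * t)"
      using t by (simp add: norm_divide norm_mult)
    moreover have "E t - L = cis (t\<^sup>2) / (2 * \<i> * complex_of_real t) - (L - G t)" by (simp add: G_def)
    ultimately have "cmod (E t - L) \<le> 1 / (2 * t) + 1 / (2 * t)"
      by (smt (verit) norm_triangle_ineq4)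
    then show "cmod (E t - L) \<le> 1 / t" by (simp add: field_simps)
  qed
qed

text \<open>Compactness covers [0, 1], the convergence rate larger t, and oddness the negative
  half-line. The constant later dominates all truncated chirp integrals of a given quadratic
  coefficient at once.\<close>

lemma fresnel_bounded: obtains C where "C > 0" "\<And>t. cmod (E t) \<le> C"
proof -
  obtain L where L: "\<And>t. 1 \<le> t \<Longrightarrow> cmod (E t - L) \<le> 1 / t" using fresnel_limit_rate by blast
  have "compact (E ` {0..1})"
    by (intro compact_continuous_image fresnel_continuous) auto
  then obtain D where D: "\<And>t. t \<in> {0..1} \<Longrightarrow> cmod (E t) \<le> D"
    using compact_imp_bounded bounded_iff by (metis imageI)
  define C where "C = max 1 (max D (cmod L + 1))"
  have 1: "cmod (E t) \<le> C" if "t \<ge> 0" for t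
  proof (cases "t \<le> 1")
    case False
    then have "cmod (E t - L) \<le> 1 / t" by (intro L) auto
    also have "\<dots> \<le> 1" using False by simp
    finally show ?thesis unfolding C_def using norm_triangle_ineq2[of "E t" L] by linarith
  next
    case True
    then show ?thesis using D[of t] that by (simp add: C_def)
  qed
  have "cmod (E t) \<le> C" for t
    using 1[of t] 1[of "-t"] by (cases "t \<ge> 0") (auto simp: fresnel_odd)
  then show ?thesis using that[of C] by (auto simp: C_def)
qed

text \<open>Differentiating the exponent in t produces a factor 1 + s^2 that cancels the weight; the
  substitution u = t s then turns the remaining integral into \<open>E t\<close>. At t = 0 only the
  weight is left, and its integral arctan 1 = pi / 4 is the source of the constant in the Fresnel
  value.\<close>

definition fresnel_J :: "real \<Rightarrow> complex" where
  "fresnel_J t = integral {0..1} (\<lambda>s. cis (t\<^sup>2 * (1 + s\<^sup>2)) * complex_of_real (1 / (1 + s\<^sup>2)))"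

lemma fresnel_J_derivative: "(fresnel_J has_vector_derivative (2 * \<i> * cis (t\<^sup>2) * E t)) (at t)"
proof -
  let ?f = "\<lambda>t s. cis (t\<^sup>2 * (1 + s\<^sup>2)) * complex_of_real (1 / (1 + s\<^sup>2))"
  let ?f' = "\<lambda>t s. 2 * \<i> * cis (t\<^sup>2) * (complex_of_real t * cis ((t * s)\<^sup>2))"
  have nz: "1 + s\<^sup>2 \<noteq> 0" for s :: real by (smt (verit) zero_le_power2)
  have nz': "1 + (complex_of_real s)\<^sup>2 \<noteq> 0" for s :: real
    using nz[of s] by (metis of_real_1 of_real_add of_real_eq_0_iff of_real_power)
  have "((\<lambda>t. integral (cbox 0 1) (?f t)) has_vector_derivative integral (cbox 0 1) (?f' t)) (at t within UNIV)"
  proof (rule leibniz_rule_vector_derivative)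
    fix t s :: real
    have "((\<lambda>t. t\<^sup>2 * (1 + s\<^sup>2)) has_real_derivative (2 * t * (1 + s\<^sup>2))) (at t)"
      by (auto intro!: derivative_eq_intros)
    from has_vector_derivative_mult_left[OF has_vector_derivative_cis[OF this], of "complex_of_real (1 / (1 + s\<^sup>2))"]
    have "((\<lambda>t. ?f t s) has_vector_derivative \<i> * complex_of_real (2 * t * (1 + s\<^sup>2)) * cis (t\<^sup>2 * (1 + s\<^sup>2)) * complex_of_real (1 / (1 + s\<^sup>2))) (at t)" .
    moreover have "\<i> * complex_of_real (2 * t * (1 + s\<^sup>2)) * cis (t\<^sup>2 * (1 + s\<^sup>2)) * complex_of_real (1 / (1 + s\<^sup>2)) = ?f' t s"
    proof -
      have "cis (t\<^sup>2 * (1 + s\<^sup>2)) = cis (t\<^sup>2) * cis ((t * s)\<^sup>2)"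
        by (simp add: cis_mult algebra_simps power_mult_distrib)
      moreover have "complex_of_real (2 * t * (1 + s\<^sup>2)) * complex_of_real (1 / (1 + s\<^sup>2)) = 2 * complex_of_real t"
        unfolding of_real_mult[symmetric] using nz[of s] by simp
      ultimately show ?thesis by (simp only: mult_ac)
    qed
    ultimately show "((\<lambda>t. ?f t s) has_vector_derivative ?f' t s) (at t within UNIV)" by simp
  next
    fix t :: real
    show "?f t integrable_on cbox 0 1"
      using nz by (intro integrable_continuous continuous_intros) auto
  next
    show "continuous_on (UNIV \<times> cbox 0 1) (\<lambda>(t, s). ?f' t s)"
      unfolding split_beta by (intro continuous_intros)
  qed auto
  moreover have "integral {0..1} (\<lambda>s. complex_of_real t * cis ((t * s)\<^sup>2)) = E t"
    using fundamental_theorem_of_calculus[of 0 1 "\<lambda>s. E (t * s)" "\<lambda>s. complex_of_real t * cis ((t * s)\<^sup>2)", OF _ fresnel_scaled]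
    by (simp only: E0 mult_zero_right mult_1_right diff_zero integral_unique zero_le_one)
  ultimately show ?thesis by (simp only: fresnel_J_def[abs_def] cbox_interval Henstock_Kurzweil_Integration.integral_mult_right)
qed

text \<open>The classical substitution for Gaussian integrals: $E(t)^2$ and $-i J(t)$ have the same derivative.
  Since $J$ vanishes at infinity, this yields $E(\infty)^2 = i\pi/4$.\<close>

lemma fresnel_square: "(E t)\<^sup>2 + \<i> * fresnel_J t = \<i> * complex_of_real (pi / 4)"
proof -
  have "((\<lambda>t. E t * E t + \<i> * fresnel_J t) has_vector_derivative 0) (at t)" for t
  proof -
    have "((\<lambda>t. E t * E t + \<i> * fresnel_J t) has_vector_derivative (E t * cis (t\<^sup>2) + cis (t\<^sup>2) * E t + \<i> * (2 * \<i> * cis (t\<^sup>2) * E t))) (at t)"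
      by (intro has_vector_derivative_add has_vector_derivative_mult has_vector_derivative_mult_right E fresnel_J_derivative)
    moreover have "E t * cis (t\<^sup>2) + cis (t\<^sup>2) * E t + \<i> * (2 * \<i> * cis (t\<^sup>2) * E t) = 0"
      by (simp add: algebra_simps)
    ultimately show ?thesis by simp
  qed
  then obtain c where c: "\<And>t. E t * E t + \<i> * fresnel_J t = c"
    using has_vector_derivative_zero_constant[of UNIV "\<lambda>t. E t * E t + \<i> * fresnel_J t"] by auto
  have "fresnel_J 0 = complex_of_real (pi / 4)"
  proof -
    have "((\<lambda>s. complex_of_real (1 / (1 + s\<^sup>2))) has_integral complex_of_real (arctan 1) - complex_of_real (arctan 0)) {0..1}"
    proof (rule fundamental_theorem_of_calculus)
      fix s :: real
      have "(arctan has_vector_derivative (1 / (1 + s\<^sup>2))) (at s within {0..1})"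
        unfolding has_real_derivative_iff_has_vector_derivative[symmetric]
        by (rule has_field_derivative_at_within) (use DERIV_arctan[of s] in \<open>simp add: inverse_eq_divide\<close>)
      then show "((\<lambda>s. complex_of_real (arctan s)) has_vector_derivative complex_of_real (1 / (1 + s\<^sup>2))) (at s within {0..1})"
        by (rule bounded_linear.has_vector_derivative[OF bounded_linear_of_real])
    qed simp
    then have "integral {0..1} (\<lambda>s. complex_of_real (1 / (1 + s\<^sup>2))) = complex_of_real (pi / 4)"
      by (simp add: integral_unique arctan_one)
    then show ?thesis by (simp add: fresnel_J_def)
  qed
  then have "c = \<i> * complex_of_real (pi / 4)" using c[of 0] by (simp only: E0 mult_zero_left add_0)
  then show ?thesis using c[of t] by (simp add: power2_eq_square)
qed

text \<open>Integration by parts against $s \mapsto E(ts)/t$, a primitive of the oscillating factor.\<close>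

lemma fresnel_J_bound:
  obtains D where "\<And>t. t > 0 \<Longrightarrow> cmod (fresnel_J t) \<le> D / t"
proof -
  obtain C where C: "C > 0" "\<And>t. cmod (E t) \<le> C" using fresnel_bounded by blast
  have "cmod (fresnel_J t) \<le> (3 * C) / t" if t: "t > 0" for t
  proof -
    let ?w = "\<lambda>s. complex_of_real (1 / (1 + s\<^sup>2))"
    let ?w' = "\<lambda>s. complex_of_real (- 2 * s / (1 + s\<^sup>2)\<^sup>2)"
    let ?g = "\<lambda>s. E (t * s) * ?w' s + complex_of_real t * cis ((t * s)\<^sup>2) * ?w s"
    have nz: "1 + s\<^sup>2 \<noteq> 0" for s :: real by (smt (verit) zero_le_power2)
    have w': "(?w has_vector_derivative ?w' s) (at s within S)" for s S
    proof -
      have "((\<lambda>s. 1 / (1 + s\<^sup>2)) has_vector_derivative (- 2 * s / (1 + s\<^sup>2)\<^sup>2)) (at s within S)"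
        unfolding has_real_derivative_iff_has_vector_derivative[symmetric]
        using nz[of s] by (auto intro!: derivative_eq_intros simp: power2_eq_square)
      then show ?thesis by (rule bounded_linear.has_vector_derivative[OF bounded_linear_of_real])
    qed
    have ct: "continuous_on S (\<lambda>s. E (t * s))" for S
      by (rule continuous_on_compose2[OF fresnel_continuous[of UNIV]]) (auto intro!: continuous_intros)
    have i1: "(\<lambda>s. E (t * s) * ?w' s) integrable_on {0..1}"
      using nz by (intro integrable_continuous_interval continuous_intros ct) auto
    have i2: "(\<lambda>s. complex_of_real t * cis ((t * s)\<^sup>2) * ?w s) integrable_on {0..1}"
      using nz by (intro integrable_continuous_interval continuous_intros) auto
    \<comment> \<open>The boundary term is \<open>E t / 2\<close>, as the weight is 1/2 at s = 1 and
      \<open>E 0 = 0\<close>. Since the derivative of the weight is at most 2 in modulus on [0, 1],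
      the total is C / 2 + 2 C, rounded up to 3 C.\<close>
    have "(?g has_integral (E (t * 1) * ?w 1 - E (t * 0) * ?w 0)) {0..1}"
      by (intro fundamental_theorem_of_calculus has_vector_derivative_mult fresnel_scaled w') auto
    then have eq: "integral {0..1} (\<lambda>s. E (t * s) * ?w' s) + integral {0..1} (\<lambda>s. complex_of_real t * cis ((t * s)\<^sup>2) * ?w s) = E t / 2"
      by (subst Henstock_Kurzweil_Integration.integral_add[OF i1 i2, symmetric]) (simp add: integral_unique E0)
    have "integral {0..1} (\<lambda>s. complex_of_real t * cis ((t * s)\<^sup>2) * ?w s) = complex_of_real t * cis (- t\<^sup>2) * fresnel_J t"
      unfolding fresnel_J_def Henstock_Kurzweil_Integration.integral_mult_right[symmetric]
    proof (rule Henstock_Kurzweil_Integration.integral_cong)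
      fix s
      have "cis ((t * s)\<^sup>2) = cis (- t\<^sup>2) * cis (t\<^sup>2 * (1 + s\<^sup>2))"
        by (simp add: cis_mult algebra_simps power_mult_distrib)
      then show "complex_of_real t * cis ((t * s)\<^sup>2) * ?w s = complex_of_real t * cis (- t\<^sup>2) * (cis (t\<^sup>2 * (1 + s\<^sup>2)) * ?w s)"
        by (simp only: mult.assoc)
    qed
    with eq have "complex_of_real t * cis (- t\<^sup>2) * fresnel_J t = E t / 2 - integral {0..1} (\<lambda>s. E (t * s) * ?w' s)"
      by (simp only: eq_diff_eq add.commute)
    then have "t * cmod (fresnel_J t) = cmod (E t / 2 - integral {0..1} (\<lambda>s. E (t * s) * ?w' s))"
      using t by (metis (no_types, lifting) norm_mult norm_cis norm_of_real abs_of_pos mult_1_right)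
    also have "\<dots> \<le> cmod (E t) / 2 + cmod (integral {0..1} (\<lambda>s. E (t * s) * ?w' s))"
      by (rule order_trans[OF norm_triangle_ineq4]) (simp only: norm_divide norm_numeral order_refl)
    also have "cmod (integral {0..1} (\<lambda>s. E (t * s) * ?w' s)) \<le> integral {0..1} (\<lambda>s::real. C * 2)"
    proof (rule integral_norm_bound_integral[OF i1])
      fix s :: real assume s: "s \<in> {0..1}"
      have "(1::real) * 1 \<le> (1 + s\<^sup>2) * (1 + s\<^sup>2)" by (intro mult_mono) auto
      then have "\<bar>- 2 * s / (1 + s\<^sup>2)\<^sup>2\<bar> \<le> 2 / 1"
        unfolding abs_divide using s by (intro frac_le) (auto simp: power2_eq_square abs_mult)
      then have "cmod (?w' s) \<le> 2" unfolding norm_of_real by simp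
      then show "cmod (E (t * s) * ?w' s) \<le> C * 2"
        unfolding norm_mult using C by (intro mult_mono) auto
    qed auto
    finally have "t * cmod (fresnel_J t) \<le> C / 2 + C * 2" using C(2)[of t] by simp
    then show ?thesis using t C(1) by (simp add: field_simps)
  qed
  then show ?thesis using that by blast
qed

text \<open>As J vanishes at infinity, the identity for the square of \<open>E\<close> gives L^2 = i
  pi / 4. The modulus of L later fixes the normalization of composed kernels.\<close>

lemma fresnel_limit:
  obtains L where "(cmod L)\<^sup>2 = pi / 4" "(E \<longlongrightarrow> L) at_top"
proof -
  obtain L where L: "\<And>t. 1 \<le> t \<Longrightarrow> cmod (E t - L) \<le> 1 / t" using fresnel_limit_rate by blast
  obtain D where D: "\<And>t. t > 0 \<Longrightarrow> cmod (fresnel_J t) \<le> D / t" using fresnel_J_bound by blast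
  have z: "((\<lambda>t::real. c / t) \<longlongrightarrow> 0) at_top" for c :: real
    by (rule tendsto_divide_0[OF tendsto_const filterlim_at_top_imp_at_infinity[OF filterlim_ident]])
  have "((\<lambda>t. E t - L) \<longlongrightarrow> 0) at_top"
    by (rule Lim_null_comparison[OF eventually_mono[OF eventually_ge_at_top[of "1::real"] L] z])
  then have EL: "(E \<longlongrightarrow> L) at_top" by (rule LIM_zero_cancel)
  have "(fresnel_J \<longlongrightarrow> 0) at_top"
    by (rule Lim_null_comparison[OF eventually_mono[OF eventually_gt_at_top[of "0::real"] D] z])
  then have "((\<lambda>t. (E t)\<^sup>2 + \<i> * fresnel_J t) \<longlongrightarrow> L\<^sup>2 + \<i> * 0) at_top"
    by (intro tendsto_intros EL)
  then have "L\<^sup>2 = \<i> * complex_of_real (pi / 4)"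
    unfolding fresnel_square using tendsto_unique[OF _ _ tendsto_const] by (metis add_0_right mult_zero_right trivial_limit_at_top_linorder)
  then have "cmod (L\<^sup>2) = pi / 4" by (simp only: norm_mult norm_of_real norm_ii) simp
  then show ?thesis using that EL by (simp add: norm_power)
qed

end

section \<open>Chirp integrals\<close>

text \<open>The integrand without cutoff has modulus 1, so the integral over the line exists only as
  a limit in \<open>m\<close>.\<close>

definition chirp_integral :: "real \<Rightarrow> real \<Rightarrow> real \<Rightarrow> complex" where
  "chirp_integral \<gamma> b m = (LINT x|lborel. indicator {-m..m} x *\<^sub>R cis (\<gamma> * x\<^sup>2 + b * x))"

lemma chirp_integral_uminus: "chirp_integral (-\<gamma>) (-b) m = cnj (chirp_integral \<gamma> b m)"
  unfolding chirp_integral_def Bochner_Integration.integral_cnj[symmetric]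
  by (rule Bochner_Integration.integral_cong[OF refl]) (simp add: cis_cnj)

text \<open>Completing the square, \<gamma> x^2 + b x = (r x + b / (2 r))^2 - b^2 / (4 \<gamma>)
  with r = sqrt \<gamma>, reduces everything to \<open>E\<close>; both endpoints contribute the
  limit L, whence \<kappa> = 2 L / r. The bound \<open>B\<close> is uniform in \<open>b\<close> and
  \<open>m\<close> for use in dominated convergence.\<close>

lemma chirp_integral_pos:
  assumes "\<gamma> > 0"
  obtains \<kappa> B where "(cmod \<kappa>)\<^sup>2 = pi / \<gamma>" "\<And>b m. m \<ge> 0 \<Longrightarrow> cmod (chirp_integral \<gamma> b m) \<le> B"
    "\<And>b. (chirp_integral \<gamma> b \<longlongrightarrow> \<kappa> * cis (- b\<^sup>2 / (4 * \<gamma>))) at_top"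
proof -
  obtain E where E: "E 0 = 0" "\<And>t. (E has_vector_derivative cis (t\<^sup>2)) (at t)"
    using fresnel_primitive by blast
  obtain C where C: "C > 0" "\<And>t. cmod (E t) \<le> C" using fresnel_bounded[OF E] by blast
  obtain L where L: "(cmod L)\<^sup>2 = pi / 4" "(E \<longlongrightarrow> L) at_top" using fresnel_limit[OF E] by blast
  define r where "r = sqrt \<gamma>"
  have r: "r > 0" "r * r = \<gamma>" using assms by (auto simp: r_def)
  define d where "d b = b / (2 * r)" for b
  have eq: "chirp_integral \<gamma> b m = cis (- b\<^sup>2 / (4 * \<gamma>)) / complex_of_real r * (E (r * m + d b) + E (r * m - d b))" 
    if "m \<ge> 0" for b m
  proof -
    let ?c = "cis (- b\<^sup>2 / (4 * \<gamma>))"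
    have sq: "\<gamma> * x\<^sup>2 + b * x = - b\<^sup>2 / (4 * \<gamma>) + (r * x + d b)\<^sup>2" for x
      using r(1) unfolding d_def r(2)[symmetric] by (simp add: power2_eq_square field_simps)
    have d': "((\<lambda>x. ?c / complex_of_real r * E (r * x + d b)) has_vector_derivative cis (\<gamma> * x\<^sup>2 + b * x)) (at x within S)" for x S
    proof -
      have "((\<lambda>x. r * x + d b) has_vector_derivative r) (at x within S)"
        by (auto intro!: derivative_eq_intros)
      from has_vector_derivative_mult_right[OF vector_diff_chain_within[OF this has_vector_derivative_at_within[OF E(2)]], of "?c / complex_of_real r"]
      have "((\<lambda>x. ?c / complex_of_real r * E (r * x + d b)) has_vector_derivative ?c / complex_of_real r * (r *\<^sub>R cis ((r * x + d b)\<^sup>2))) (at x within S)"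
        by (simp add: o_def)
      moreover have "?c / complex_of_real r * (r *\<^sub>R cis ((r * x + d b)\<^sup>2)) = cis (\<gamma> * x\<^sup>2 + b * x)"
        unfolding sq using r(1) by (simp add: scaleR_conv_of_real cis_mult)
      ultimately show ?thesis by simp
    qed
    have "chirp_integral \<gamma> b m = ?c / complex_of_real r * E (r * m + d b) - ?c / complex_of_real r * E (r * (- m) + d b)"
      unfolding chirp_integral_def
    proof (rule integral_FTC_Icc)
      show "- m \<le> m" using that by simp
      show "continuous_on {- m..m} (\<lambda>x. cis (\<gamma> * x\<^sup>2 + b * x))"
        by (intro continuous_intros)
    qed (rule d')
    also have "E (r * (- m) + d b) = - E (r * m - d b)"
      using fresnel_odd[OF E, of "r * m - d b"] by simp
    finally show ?thesis by (simp only: ring_distribs mult_minus_right diff_minus_eq_add)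
  qed
  show ?thesis
  proof (rule that)
    show "(cmod (2 * L / complex_of_real r))\<^sup>2 = pi / \<gamma>"
      using r L(1) by (simp add: norm_divide norm_mult power_divide power_mult_distrib power2_eq_square)
    show "cmod (chirp_integral \<gamma> b m) \<le> 2 * C / r" if "m \<ge> 0" for b m
    proof -
      have "cmod (E (r * m + d b) + E (r * m - d b)) \<le> 2 * C"
        using norm_triangle_ineq[of "E (r * m + d b)" "E (r * m - d b)"] C(2)[of "r * m + d b"] C(2)[of "r * m - d b"] by linarith
      then show ?thesis
        unfolding eq[OF that] norm_mult norm_divide using r(1) by (simp add: divide_right_mono)
    qed
    fix b
    have lin: "filterlim (\<lambda>m. r * m + u) at_top at_top" for u
      using filterlim_tendsto_add_at_top[OF tendsto_const[of u] filterlim_tendsto_pos_mult_at_top[OF tendsto_const r(1) filterlim_ident]] 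
      by (simp only: add.commute)
    have "((\<lambda>m. cis (- b\<^sup>2 / (4 * \<gamma>)) / complex_of_real r * (E (r * m + d b) + E (r * m + (- d b)))) \<longlongrightarrow> cis (- b\<^sup>2 / (4 * \<gamma>)) / complex_of_real r * (L + L)) at_top"
      by (intro tendsto_mult tendsto_const tendsto_add filterlim_compose[OF L(2) lin])
    moreover have "eventually (\<lambda>m. cis (- b\<^sup>2 / (4 * \<gamma>)) / complex_of_real r * (E (r * m + d b) + E (r * m + (- d b))) = chirp_integral \<gamma> b m) at_top"
      using eventually_ge_at_top[of "0::real"] by eventually_elim (simp add: eq)
    ultimately have "(chirp_integral \<gamma> b \<longlongrightarrow> cis (- b\<^sup>2 / (4 * \<gamma>)) / complex_of_real r * (L + L)) at_top"
      by (rule Lim_transform_eventually)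
    then show "(chirp_integral \<gamma> b \<longlongrightarrow> 2 * L / complex_of_real r * cis (- b\<^sup>2 / (4 * \<gamma>))) at_top"
      by (simp add: mult_ac flip: mult_2)
  qed
qed

text \<open>Conjugation reverses the signs of \<gamma> and b, which reduces negative \<gamma> to the
  positive case.\<close>

lemma chirp_integral_limit:
  assumes "\<gamma> \<noteq> 0"
  obtains \<kappa> B where "(cmod \<kappa>)\<^sup>2 = pi / \<bar>\<gamma>\<bar>" "\<And>b m. m \<ge> 0 \<Longrightarrow> cmod (chirp_integral \<gamma> b m) \<le> B"
    "\<And>b. (chirp_integral \<gamma> b \<longlongrightarrow> \<kappa> * cis (- b\<^sup>2 / (4 * \<gamma>))) at_top"
proof (cases "\<gamma> > 0")
  case True
  then obtain \<kappa> B where "(cmod \<kappa>)\<^sup>2 = pi / \<gamma>" "\<And>b m. m \<ge> 0 \<Longrightarrow> cmod (chirp_integral \<gamma> b m) \<le> B"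
    "\<And>b. (chirp_integral \<gamma> b \<longlongrightarrow> \<kappa> * cis (- b\<^sup>2 / (4 * \<gamma>))) at_top"
    by (rule chirp_integral_pos) (rule that)
  then show ?thesis using True by (intro that) auto
next
  case False
  with assms have "- \<gamma> > 0" by simp
  then obtain \<kappa> B where *: "(cmod \<kappa>)\<^sup>2 = pi / (- \<gamma>)" "\<And>b m. m \<ge> 0 \<Longrightarrow> cmod (chirp_integral (-\<gamma>) b m) \<le> B"
    "\<And>b. (chirp_integral (-\<gamma>) b \<longlongrightarrow> \<kappa> * cis (- b\<^sup>2 / (4 * (- \<gamma>)))) at_top"
    by (rule chirp_integral_pos) (rule that)
  have eq: "chirp_integral \<gamma> b = (\<lambda>m. cnj (chirp_integral (-\<gamma>) (-b) m))" for b
    using chirp_integral_uminus[of "-\<gamma>" "-b"] by auto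
  show ?thesis
  proof (rule that)
    show "(cmod (cnj \<kappa>))\<^sup>2 = pi / \<bar>\<gamma>\<bar>" using *(1) False by simp
    show "cmod (chirp_integral \<gamma> b m) \<le> B" if "m \<ge> 0" for b m
      unfolding eq using *(2)[OF that] by simp
    show "(chirp_integral \<gamma> b \<longlongrightarrow> cnj \<kappa> * cis (- b\<^sup>2 / (4 * \<gamma>))) at_top" for b
      unfolding eq using tendsto_cnj[OF *(3)[of "-b"]] by (simp add: cis_cnj)
  qed
qed

section \<open>Linear canonical transforms on $L^2$\<close>

lemma L2_measurable: "L2 f \<Longrightarrow> f \<in> borel_measurable borel"
  by (simp add: L2_def)

lemma L2_bcs: "bcs h \<Longrightarrow> L2 h"
  using bcs_measurable bcs_norm2_integrable by (simp add: L2_def)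

lemma L2_integrable_mult_cnj:
  assumes "L2 f" "L2 g" shows "integrable lborel (\<lambda>x. f x * cnj (g x))"
proof (rule Bochner_Integration.integrable_bound)
  show "integrable lborel (\<lambda>x. (cmod (f x))\<^sup>2 + (cmod (g x))\<^sup>2)"
    using assms by (simp add: L2_def)
  have [measurable]: "f \<in> borel_measurable borel" "g \<in> borel_measurable borel"
    by (rule L2_measurable[OF assms(1)]) (rule L2_measurable[OF assms(2)])
  show "(\<lambda>x. f x * cnj (g x)) \<in> borel_measurable lborel" by measurable
  show "AE x in lborel. cmod (f x * cnj (g x)) \<le> norm ((cmod (f x))\<^sup>2 + (cmod (g x))\<^sup>2)"
  proof (rule AE_I2)
    fix x
    have "2 * (cmod (f x) * cmod (g x)) \<le> (cmod (f x))\<^sup>2 + (cmod (g x))\<^sup>2"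
      using sum_squares_bound[of "cmod (f x)" "cmod (g x)"] by (simp add: mult_ac)
    moreover have "0 \<le> cmod (f x) * cmod (g x)" by simp
    ultimately have "cmod (f x) * cmod (g x) \<le> (cmod (f x))\<^sup>2 + (cmod (g x))\<^sup>2" by linarith
    then show "cmod (f x * cnj (g x)) \<le> norm ((cmod (f x))\<^sup>2 + (cmod (g x))\<^sup>2)"
      by (simp add: norm_mult)
  qed
qed

lemma cmod_diff_power2: "(cmod (z - w))\<^sup>2 = (cmod z)\<^sup>2 + (cmod w)\<^sup>2 - 2 * Re (z * cnj w)"
  by (simp only: cmod_power2) (simp add: power2_eq_square algebra_simps)

lemma L2_diff_norm:
  assumes "L2 f" "L2 g"
  shows "integrable lborel (\<lambda>x. (cmod (f x - g x))\<^sup>2)"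
    and "(LINT x|lborel. (cmod (f x - g x))\<^sup>2) = (LINT x|lborel. (cmod (f x))\<^sup>2) + (LINT x|lborel. (cmod (g x))\<^sup>2)
        - 2 * Re (LINT x|lborel. f x * cnj (g x))"
proof -
  have i: "integrable lborel (\<lambda>x. (cmod (f x))\<^sup>2)" "integrable lborel (\<lambda>x. (cmod (g x))\<^sup>2)" 
    "integrable lborel (\<lambda>x. Re (f x * cnj (g x)))"
    using assms(1) assms(2) integrable_Re[OF L2_integrable_mult_cnj[OF assms]] unfolding L2_def by blast+
  show "integrable lborel (\<lambda>x. (cmod (f x - g x))\<^sup>2)"
    unfolding cmod_diff_power2 by (intro Bochner_Integration.integrable_diff Bochner_Integration.integrable_add integrable_mult_right i)
  show "(LINT x|lborel. (cmod (f x - g x))\<^sup>2) = (LINT x|lborel. (cmod (f x))\<^sup>2) + (LINT x|lborel. (cmod (g x))\<^sup>2)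
        - 2 * Re (LINT x|lborel. f x * cnj (g x))"
    unfolding cmod_diff_power2 integral_Re[OF L2_integrable_mult_cnj[OF assms], symmetric]
      integral_mult_right_zero[symmetric] Bochner_Integration.integral_add[OF i(1,2), symmetric]
    by (rule Bochner_Integration.integral_diff[OF Bochner_Integration.integrable_add[OF i(1,2)] integrable_mult_right[OF i(3)]])
qed

lemma L2_diff: "L2 f \<Longrightarrow> L2 g \<Longrightarrow> L2 (\<lambda>x. f x - g x)"
  using borel_measurable_diff[OF L2_measurable L2_measurable, of f g] L2_diff_norm(1)[of f g]
  by (simp add: L2_def[of "\<lambda>x. f x - g x"])

lemma L2_uminus: "L2 f \<Longrightarrow> L2 (\<lambda>x. - f x)"
  by (simp add: L2_def)

lemma L2_add: "L2 f \<Longrightarrow> L2 g \<Longrightarrow> L2 (\<lambda>x. f x + g x)"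
  using L2_diff[of f "\<lambda>x. - g x"] L2_uminus by simp

lemma L2_zero: "L2 (\<lambda>x. 0)"
  by (simp add: L2_def)

lemma trunc_indicator: "trunc n f x = indicator {- real n..real n} x * f x"
  by (simp add: trunc_def)

lemma trunc_tendsto: "(\<lambda>n. trunc n f x) \<longlonglongrightarrow> f x"
proof (rule tendsto_eventually)
  show "eventually (\<lambda>n. trunc n f x = f x) sequentially"
    using eventually_ge_at_top[of "nat \<lceil>\<bar>x\<bar>\<rceil>"]
  proof eventually_elim
    case (elim n)
    then have "\<bar>x\<bar> \<le> real n" by linarith
    then show ?case by (auto simp: trunc_def abs_le_iff)
  qed
qed

lemma cmod_trunc_le: "cmod (trunc n f x) \<le> cmod (f x)"
  by (simp add: trunc_def)

lemma trunc_measurable: "f \<in> borel_measurable borel \<Longrightarrow> trunc n f \<in> borel_measurable borel"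
  unfolding trunc_indicator[abs_def] by measurable

lemma L2_trunc:
  assumes "L2 f" shows "L2 (trunc n f)"
proof -
  have m: "trunc n f \<in> borel_measurable borel" by (rule trunc_measurable[OF L2_measurable[OF assms]])
  have "integrable lborel (\<lambda>x. (cmod (trunc n f x))\<^sup>2)"
  proof (rule Bochner_Integration.integrable_bound)
    show "integrable lborel (\<lambda>x. (cmod (f x))\<^sup>2)" using assms by (simp add: L2_def)
    show "(\<lambda>x. (cmod (trunc n f x))\<^sup>2) \<in> borel_measurable lborel" using m by measurable
    show "AE x in lborel. norm ((cmod (trunc n f x))\<^sup>2) \<le> norm ((cmod (f x))\<^sup>2)"
      by (intro AE_I2) (simp add: cmod_trunc_le power_mono)
  qed
  with m show ?thesis by (simp add: L2_def)
qed

lemma trunc_norm_tendsto: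
  assumes "L2 f"
  shows "(\<lambda>n. LINT x|lborel. (cmod (trunc n f x))\<^sup>2) \<longlonglongrightarrow> (LINT x|lborel. (cmod (f x))\<^sup>2)"
proof (rule integral_dominated_convergence)
  show "integrable lborel (\<lambda>x. (cmod (f x))\<^sup>2)" using assms by (simp add: L2_def)
  show "(\<lambda>x. (cmod (f x))\<^sup>2) \<in> borel_measurable lborel" using L2_measurable[OF assms] by measurable
  show "(\<lambda>x. (cmod (trunc n f x))\<^sup>2) \<in> borel_measurable lborel" for n 
    using L2_measurable[OF L2_trunc[OF assms]] by measurable
  show "AE x in lborel. (\<lambda>n. (cmod (trunc n f x))\<^sup>2) \<longlonglongrightarrow> (cmod (f x))\<^sup>2"
    by (intro AE_I2 tendsto_intros trunc_tendsto)
  show "AE x in lborel. norm ((cmod (trunc n f x))\<^sup>2) \<le> (cmod (f x))\<^sup>2" for n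
    by (intro AE_I2) (simp add: cmod_trunc_le power_mono)
qed

section \<open>Kernels with quadratic phase: isometry and adjoint\<close>

text \<open>The integral operator with kernel
  \<open>A * cis (p * \<xi>\<^sup>2 + a * x * \<xi> + q * x\<^sup>2)\<close>. Fractional Fourier
  transforms of angles in (0, pi/2], their adjoints, and the mixed products for two distinct angles
  all have this shape.\<close>

definition lct :: "complex \<Rightarrow> real \<Rightarrow> real \<Rightarrow> real \<Rightarrow> (real \<Rightarrow> complex) \<Rightarrow> real \<Rightarrow> complex" where
  "lct A p q a h \<xi> = A * cis (p * \<xi>\<^sup>2) * ft a (\<lambda>x. cis (q * x\<^sup>2) * h x) \<xi>"

lemma lct_measurable:
  assumes [measurable]: "h \<in> borel_measurable borel" 
  shows "lct A p q a h \<in> borel_measurable borel"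
proof -
  have [measurable]: "ft a (\<lambda>x. cis (q * x\<^sup>2) * h x) \<in> borel_measurable borel"
    by (rule borel_measurable_ft) measurable
  show ?thesis unfolding lct_def[abs_def] by measurable
qed

lemma cmod_lct_le:
  assumes "bcs h" shows "cmod (lct A p q a h \<xi>) \<le> cmod A * (LINT x|lborel. cmod (h x))"
  using cmod_ft_le[OF bcs_cis_mult[OF assms], of "\<lambda>x. q * x\<^sup>2" a \<xi>]
  by (auto simp: lct_def norm_mult intro: mult_left_mono)

lemma lct_plancherel:
  assumes "bcs h" "a \<noteq> 0"
  shows "L2 (lct A p q a h)"
    and "(LINT \<xi>|lborel. (cmod (lct A p q a h \<xi>))\<^sup>2) = (cmod A)\<^sup>2 * (2 * pi) / \<bar>a\<bar> * (LINT x|lborel. (cmod (h x))\<^sup>2)"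
proof -
  have b: "bcs (\<lambda>x. cis (q * x\<^sup>2) * h x)" by (rule bcs_cis_mult[OF assms(1)]) measurable
  have eq: "(cmod (lct A p q a h \<xi>))\<^sup>2 = (cmod A)\<^sup>2 * (cmod (ft a (\<lambda>x. cis (q * x\<^sup>2) * h x) \<xi>))\<^sup>2" for \<xi>
    by (simp add: lct_def norm_mult power_mult_distrib)
  show "L2 (lct A p q a h)"
    using plancherel_ft(1)[OF b assms(2)] lct_measurable[OF bcs_measurable[OF assms(1)]] unfolding L2_def eq by simp
  show "(LINT \<xi>|lborel. (cmod (lct A p q a h \<xi>))\<^sup>2) = (cmod A)\<^sup>2 * (2 * pi) / \<bar>a\<bar> * (LINT x|lborel. (cmod (h x))\<^sup>2)"
    unfolding eq integral_mult_right_zero plancherel_ft(2)[OF b assms(2)] by (simp add: norm_mult)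
qed

lemma lct_isometry:
  assumes "bcs h" "a \<noteq> 0" "(cmod A)\<^sup>2 * (2 * pi) = \<bar>a\<bar>"
  shows "(LINT \<xi>|lborel. (cmod (lct A p q a h \<xi>))\<^sup>2) = (LINT x|lborel. (cmod (h x))\<^sup>2)"
  unfolding lct_plancherel(2)[OF assms(1,2)] assms(3) using assms(2) by simp

text \<open>Conjugating the kernel and exchanging its two variables swaps and negates
  \<open>p\<close> and \<open>q\<close>, and negates \<open>a\<close>. Compact support of both
  functions justifies Fubini.\<close>

lemma lct_adjoint:
  assumes "bcs h" "bcs g"
  shows "(LINT \<xi>|lborel. lct A p q a h \<xi> * cnj (g \<xi>)) = (LINT x|lborel. h x * cnj (lct (cnj A) (-q) (-p) (-a) g x))"
proof -
  obtain B R where h: "B > 0" "R > 0" "\<And>x. cmod (h x) \<le> B" "\<And>x. R < \<bar>x\<bar> \<Longrightarrow> h x = 0"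
    using bcsE[OF assms(1)] by blast
  obtain B' R' where g: "B' > 0" "R' > 0" "\<And>x. cmod (g x) \<le> B'" "\<And>x. R' < \<bar>x\<bar> \<Longrightarrow> g x = 0"
    using bcsE[OF assms(2)] by blast
  have [measurable]: "h \<in> borel_measurable borel" "g \<in> borel_measurable borel" 
    by (rule bcs_measurable[OF assms(1)]) (rule bcs_measurable[OF assms(2)])
  let ?F = "\<lambda>x \<xi>. A * cis (p * \<xi>\<^sup>2) * cis (a * x * \<xi>) * cis (q * x\<^sup>2) * h x * cnj (g \<xi>)"
  have "(LINT \<xi>|lborel. lct A p q a h \<xi> * cnj (g \<xi>)) = (LINT \<xi>|lborel. LINT x|lborel. ?F x \<xi>)"
  proof (rule Bochner_Integration.integral_cong[OF refl])
    fix \<xi>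
    have "lct A p q a h \<xi> * cnj (g \<xi>) = (LINT x|lborel. A * cis (p * \<xi>\<^sup>2) * (cis (a * x * \<xi>) * (cis (q * x\<^sup>2) * h x)) * cnj (g \<xi>))"
      unfolding lct_def ft_def by (simp only: integral_mult_left_zero integral_mult_right_zero)
    then show "lct A p q a h \<xi> * cnj (g \<xi>) = (LINT x|lborel. ?F x \<xi>)" by (simp only: mult.assoc)
  qed
  also have "\<dots> = (LINT x|lborel. LINT \<xi>|lborel. ?F x \<xi>)"
  proof (rule Fubini_bcs_bounded[where R="max R R'" and B="cmod A * B * B'"])
    show "(\<lambda>(x, \<xi>). ?F x \<xi>) \<in> borel_measurable (lborel \<Otimes>\<^sub>M lborel)" by measurable
    show "cmod (?F x \<xi>) \<le> cmod A * B * B'" for x \<xi>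
      unfolding norm_mult norm_cis complex_mod_cnj mult_1_right
      using h(1) by (intro mult_mono[OF mult_left_mono[OF h(3)] g(3)]) simp_all
    show "?F x \<xi> = 0" if "max R R' < \<bar>x\<bar> \<or> max R R' < \<bar>\<xi>\<bar>" for x \<xi>
    proof -
      have "R < \<bar>x\<bar> \<or> R' < \<bar>\<xi>\<bar>" using that by linarith
      then have "h x = 0 \<or> g \<xi> = 0" using h(4) g(4) by blast
      then show ?thesis by (elim disjE) simp_all
    qed
  qed
  also have "\<dots> = (LINT x|lborel. h x * cnj (lct (cnj A) (-q) (-p) (-a) g x))"
  proof (rule Bochner_Integration.integral_cong[OF refl])
    fix x
    have "h x * cnj (lct (cnj A) (-q) (-p) (-a) g x) = (LINT \<xi>|lborel. h x * cnj (cnj A * cis (- q * x\<^sup>2) * (cis (- a * \<xi> * x) * (cis (- p * \<xi>\<^sup>2) * g \<xi>))))"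
      unfolding lct_def ft_def by (simp only: integral_mult_right_zero Bochner_Integration.integral_cnj)
    also have "\<dots> = (LINT \<xi>|lborel. ?F x \<xi>)"
      by (rule Bochner_Integration.integral_cong[OF refl]) (simp add: cis_cnj mult_ac)
    finally show "(LINT \<xi>|lborel. ?F x \<xi>) = h x * cnj (lct (cnj A) (-q) (-p) (-a) g x)" ..
  qed
  finally show ?thesis .
qed

section \<open>Identification of L^2 limits\<close>

text \<open>Ensures that truncations are bounded with compact support. Transforms of compactly
  supported functions satisfy it, though their own support need not be compact.\<close>

definition locally_bounded :: "(real \<Rightarrow> complex) \<Rightarrow> bool" where
  "locally_bounded u \<longleftrightarrow> (\<forall>R. \<exists>B. \<forall>x. \<bar>x\<bar> \<le> R \<longrightarrow> cmod (u x) \<le> B)"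

lemma locally_boundedI: "(\<And>x. cmod (u x) \<le> B) \<Longrightarrow> locally_bounded u"
  unfolding locally_bounded_def by (intro allI exI[of _ B]) simp

lemma locally_bounded_bcs: "bcs h \<Longrightarrow> locally_bounded h"
  by (erule bcsE) (rule locally_boundedI)

lemma locally_bounded_lct: "bcs h \<Longrightarrow> locally_bounded (lct A p q a h)"
  by (rule locally_boundedI[OF cmod_lct_le])

lemma bcs_trunc_locally_bounded: "u \<in> borel_measurable borel \<Longrightarrow> locally_bounded u \<Longrightarrow> bcs (trunc n u)"
  by (rule bcs_trunc) (simp_all add: locally_bounded_def)

text \<open>With $U_n$ the transform of the truncation $u_n$, the assumptions on the adjoint give
  $\langle U_n, G\rangle = \|u_n\|^2$, hence $\|U_n - G\|^2 = \|u\|^2 - \|u_n\|^2$.\<close>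

lemma lct_extension:
  assumes a: "a \<noteq> 0" and A: "(cmod A)\<^sup>2 * (2 * pi) = \<bar>a\<bar>"
    and u: "L2 u" "locally_bounded u" and G: "L2 G" "locally_bounded G"
    and norm: "(LINT x|lborel. (cmod (G x))\<^sup>2) = (LINT x|lborel. (cmod (u x))\<^sup>2)"
    and bound: "\<And>m x. cmod (lct (cnj A) (-q) (-p) (-a) (trunc m G) x) \<le> B"
    and lim: "\<And>x. (\<lambda>m. lct (cnj A) (-q) (-p) (-a) (trunc m G) x) \<longlonglongrightarrow> u x"
  shows "(\<lambda>n. \<integral>\<^sup>+ \<xi>. ennreal ((cmod (lct A p q a (trunc n u) \<xi> - G \<xi>))\<^sup>2) \<partial>lborel) \<longlonglongrightarrow> 0"
proof -
  have bu: "bcs (trunc n u)" and bG: "bcs (trunc n G)" for n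
    by (intro bcs_trunc_locally_bounded L2_measurable u G)+
  have [measurable]: "u \<in> borel_measurable borel" "G \<in> borel_measurable borel"
    "trunc n u \<in> borel_measurable borel" "trunc n G \<in> borel_measurable borel" for n
    by (intro L2_measurable bcs_measurable u G bu bG)+
  have "(\<integral>\<^sup>+ \<xi>. ennreal ((cmod (lct A p q a (trunc n u) \<xi> - G \<xi>))\<^sup>2) \<partial>lborel)
    = ennreal ((LINT x|lborel. (cmod (u x))\<^sup>2) - (LINT x|lborel. (cmod (trunc n u x))\<^sup>2))" for n
  proof -
    let ?U = "lct A p q a (trunc n u)"
    have U: "L2 ?U" "(LINT \<xi>|lborel. (cmod (?U \<xi>))\<^sup>2) = (LINT x|lborel. (cmod (trunc n u x))\<^sup>2)"
      by (rule lct_plancherel(1)[OF bu a]) (rule lct_isometry[OF bu a A])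
    have [measurable]: "?U \<in> borel_measurable borel" using U by (simp add: L2_measurable)
    \<comment> \<open>The adjoint formula asks for compact support on both sides, so the pairing
      with \<open>G\<close> is approached through truncations of \<open>G\<close>. The same sequence
      is then evaluated a second time on the adjoint side.\<close>
    have "(\<lambda>m. LINT \<xi>|lborel. ?U \<xi> * cnj (trunc m G \<xi>)) \<longlonglongrightarrow> (LINT \<xi>|lborel. ?U \<xi> * cnj (G \<xi>))"
    proof (rule integral_dominated_convergence)
      show "integrable lborel (\<lambda>\<xi>. cmod (?U \<xi> * cnj (G \<xi>)))"
        by (rule integrable_norm[OF L2_integrable_mult_cnj[OF U(1) G(1)]])
      show "AE x in lborel. (\<lambda>m. ?U x * cnj (trunc m G x)) \<longlonglongrightarrow> ?U x * cnj (G x)"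
        by (intro AE_I2 tendsto_intros trunc_tendsto)
      show "AE x in lborel. cmod (?U x * cnj (trunc m G x)) \<le> cmod (?U x * cnj (G x))" for m
        by (intro AE_I2) (simp add: norm_mult cmod_trunc_le mult_left_mono)
    qed measurable
    moreover have "(\<lambda>m. LINT \<xi>|lborel. ?U \<xi> * cnj (trunc m G \<xi>)) \<longlonglongrightarrow> (LINT x|lborel. trunc n u x * cnj (u x))"
      unfolding lct_adjoint[OF bu bG]
    proof (rule integral_dominated_convergence)
      show "integrable lborel (\<lambda>x. cmod (trunc n u x) * B)"
        by (intro integrable_mult_left integrable_norm bcs_integrable bu)
      show "AE x in lborel. (\<lambda>m. trunc n u x * cnj (lct (cnj A) (- q) (- p) (- a) (trunc m G) x)) \<longlonglongrightarrow> trunc n u x * cnj (u x)"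
        by (intro AE_I2 tendsto_intros lim)
      show "AE x in lborel. cmod (trunc n u x * cnj (lct (cnj A) (- q) (- p) (- a) (trunc m G) x)) \<le> cmod (trunc n u x) * B" for m
        using bound by (intro AE_I2) (simp add: norm_mult mult_left_mono)
      show "(\<lambda>x. trunc n u x * cnj (lct (cnj A) (- q) (- p) (- a) (trunc m G) x)) \<in> borel_measurable lborel" for m
        using lct_measurable[OF bcs_measurable[OF bG]] by measurable
    qed measurable
    ultimately have "(LINT \<xi>|lborel. ?U \<xi> * cnj (G \<xi>)) = (LINT x|lborel. trunc n u x * cnj (u x))"
      by (rule LIMSEQ_unique)
    \<comment> \<open>On the truncation interval \<open>u\<close> and \<open>trunc n u\<close>
      agree; elsewhere the product vanishes.\<close>
    also have "\<dots> = (LINT x|lborel. complex_of_real ((cmod (trunc n u x))\<^sup>2))"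
      unfolding cmod_mult_cnj_real[symmetric] by (rule Bochner_Integration.integral_cong[OF refl]) (simp add: trunc_def)
    also have "\<dots> = complex_of_real (LINT x|lborel. (cmod (trunc n u x))\<^sup>2)"
      by (rule integral_complex_of_real)
    finally have "(LINT x|lborel. (cmod (?U x - G x))\<^sup>2) = (LINT x|lborel. (cmod (u x))\<^sup>2) - (LINT x|lborel. (cmod (trunc n u x))\<^sup>2)"
      unfolding L2_diff_norm(2)[OF U(1) G(1)] U(2) norm by simp
    then show ?thesis
      using nn_integral_eq_integral[OF L2_diff_norm(1)[OF U(1) G(1)]] by simp
  qed
  moreover have "(\<lambda>n. ennreal ((LINT x|lborel. (cmod (u x))\<^sup>2) - (LINT x|lborel. (cmod (trunc n u x))\<^sup>2))) \<longlonglongrightarrow> ennreal 0"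
    using tendsto_diff[OF tendsto_const[of "LINT x|lborel. (cmod (u x))\<^sup>2"] trunc_norm_tendsto[OF u(1)]] 
    by (intro tendsto_ennrealI) (simp only: diff_self)
  ultimately show ?thesis by simp
qed

text \<open>The adjoint of an isometric kernel is a right inverse. This is the extension criterion
  with \<open>G = h\<close>: since \<open>trunc m h = h\<close> for large m, the adjoint of the
  truncations is eventually constant in m, and the L^1 norm of \<open>h\<close> gives the
  bound.\<close>

lemma lct_inverse:
  assumes a: "a \<noteq> 0" and A: "(cmod A)\<^sup>2 * (2 * pi) = \<bar>a\<bar>" and h: "bcs h"
  shows "(\<lambda>n. \<integral>\<^sup>+ \<xi>. ennreal ((cmod (lct A p q a (trunc n (lct (cnj A) (-q) (-p) (-a) h)) \<xi> - h \<xi>))\<^sup>2) \<partial>lborel) \<longlonglongrightarrow> 0"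
proof (rule lct_extension[OF a A])
  let ?u = "lct (cnj A) (-q) (-p) (-a) h"
  show "L2 ?u" "locally_bounded ?u" "L2 h" "locally_bounded h"
    using a by (auto intro: lct_plancherel(1) locally_bounded_lct L2_bcs locally_bounded_bcs h)
  show "(LINT x|lborel. (cmod (h x))\<^sup>2) = (LINT x|lborel. (cmod (?u x))\<^sup>2)"
    using lct_isometry[OF h, of "-a" "cnj A"] A a by simp
  have "(LINT x|lborel. cmod (trunc m h x)) \<le> (LINT x|lborel. cmod (h x))" for m
  proof (rule integral_mono)
    show "integrable lborel (\<lambda>x. cmod (h x))" by (intro integrable_norm bcs_integrable h)
    show "integrable lborel (\<lambda>x. cmod (trunc m h x))" 
      by (intro integrable_norm bcs_integrable bcs_trunc_locally_bounded bcs_measurable locally_bounded_bcs h)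
  qed (rule cmod_trunc_le)
  moreover have "bcs (trunc m h)" for m
    by (intro bcs_trunc_locally_bounded bcs_measurable locally_bounded_bcs h)
  ultimately show "cmod (lct (cnj A) (-q) (-p) (-a) (trunc m h) x) \<le> cmod (cnj A) * (LINT x|lborel. cmod (h x))" for m x
    by (intro order_trans[OF cmod_lct_le] mult_left_mono) auto
  show "(\<lambda>m. lct (cnj A) (-q) (-p) (-a) (trunc m h) x) \<longlonglongrightarrow> ?u x" for x
    using trunc_bcs_eventually[OF h] by (intro tendsto_eventually) (auto elim: eventually_mono)
qed

section \<open>Composition of two kernels\<close>

text \<open>The truncation confines the intermediate variable to [-m, m], so Fubini lets it be
  integrated first. Its total phase is quadratic, hence the inner integral is a chirp integral with
  coefficients p3 - p and a3 \<eta> - a x.\<close>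

lemma lct_trunc_lct:
  assumes "bcs h"
  shows "lct (cnj A) (-q) (-p) (-a) (trunc m (lct A3 p3 q3 a3 h)) x =
    cnj A * A3 * cis (- q * x\<^sup>2) * (LINT \<eta>|lborel. cis (q3 * \<eta>\<^sup>2) * h \<eta> * chirp_integral (p3 - p) (a3 * \<eta> - a * x) (real m))"
proof -
  obtain B R where h: "B > 0" "R > 0" "\<And>x. cmod (h x) \<le> B" "\<And>x. R < \<bar>x\<bar> \<Longrightarrow> h x = 0"
    using bcsE[OF assms] by blast
  have [measurable]: "h \<in> borel_measurable borel" by (rule bcs_measurable[OF assms])
  let ?I = "\<lambda>\<xi>. indicator {- real m..real m} \<xi> :: complex"
  let ?k = "\<lambda>\<xi>. cis (- a * \<xi> * x) * (cis (- p * \<xi>\<^sup>2) * (?I \<xi> * (A3 * cis (p3 * \<xi>\<^sup>2))))"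
  let ?F = "\<lambda>\<eta> \<xi>. ?k \<xi> * (cis (a3 * \<eta> * \<xi>) * (cis (q3 * \<eta>\<^sup>2) * h \<eta>))"
  have "(LINT \<xi>|lborel. cis (- a * \<xi> * x) * (cis (- p * \<xi>\<^sup>2) * trunc m (lct A3 p3 q3 a3 h) \<xi>))
     = (LINT \<xi>|lborel. LINT \<eta>|lborel. ?F \<eta> \<xi>)"
    unfolding integral_mult_right_zero trunc_indicator lct_def ft_def by (simp only: mult.assoc)
  also have "\<dots> = (LINT \<eta>|lborel. LINT \<xi>|lborel. ?F \<eta> \<xi>)"
  proof (rule Fubini_bcs_bounded[where R="max R m" and B="cmod A3 * B"])
    show "(\<lambda>(\<eta>, \<xi>). ?F \<eta> \<xi>) \<in> borel_measurable (lborel \<Otimes>\<^sub>M lborel)" by measurable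
    show "cmod (?F \<eta> \<xi>) \<le> cmod A3 * B" for \<eta> \<xi>
    proof -
      have "cmod (?I \<xi>) * cmod A3 \<le> 1 * cmod A3" by (intro mult_right_mono) (auto simp: indicator_def)
      then have "(cmod (?I \<xi>) * cmod A3) * cmod (h \<eta>) \<le> cmod A3 * B"
        using h(3)[of \<eta>] by (intro mult_mono) auto
      then show ?thesis unfolding norm_mult norm_cis by simp
    qed
    show "?F \<eta> \<xi> = 0" if "max R m < \<bar>\<eta>\<bar> \<or> max R m < \<bar>\<xi>\<bar>" for \<eta> \<xi>
    proof -
      have "R < \<bar>\<eta>\<bar> \<or> m < \<bar>\<xi>\<bar>" using that by linarith
      then have "h \<eta> = 0 \<or> ?I \<xi> = 0" using h(4)[of \<eta>] by (auto simp: indicator_def abs_if split: if_splits)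
      then show ?thesis by (elim disjE) simp_all
    qed
  qed
  also have "\<dots> = (LINT \<eta>|lborel. A3 * (cis (q3 * \<eta>\<^sup>2) * h \<eta> * chirp_integral (p3 - p) (a3 * \<eta> - a * x) (real m)))"
  proof (rule Bochner_Integration.integral_cong[OF refl])
    fix \<eta>
    have "?F \<eta> \<xi> = A3 * (cis (q3 * \<eta>\<^sup>2) * h \<eta>) * (indicator {- real m..real m} \<xi> *\<^sub>R cis ((p3 - p) * \<xi>\<^sup>2 + (a3 * \<eta> - a * x) * \<xi>))" for \<xi>
    proof -
      have "cis ((p3 - p) * \<xi>\<^sup>2 + (a3 * \<eta> - a * x) * \<xi>) = cis (- a * \<xi> * x) * cis (- p * \<xi>\<^sup>2) * cis (p3 * \<xi>\<^sup>2) * cis (a3 * \<eta> * \<xi>)"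
        by (simp add: cis_mult algebra_simps)
      moreover have "indicator {- real m..real m} \<xi> *\<^sub>R z = ?I \<xi> * z" for z
        by (simp add: indicator_def)
      ultimately show ?thesis by (simp only: mult_ac)
    qed
    then show "(LINT \<xi>|lborel. ?F \<eta> \<xi>) = A3 * (cis (q3 * \<eta>\<^sup>2) * h \<eta> * chirp_integral (p3 - p) (a3 * \<eta> - a * x) (real m))"
      unfolding chirp_integral_def by (simp only: integral_mult_right_zero mult.assoc)
  qed
  also have "\<dots> = A3 * (LINT \<eta>|lborel. cis (q3 * \<eta>\<^sup>2) * h \<eta> * chirp_integral (p3 - p) (a3 * \<eta> - a * x) (real m))"
    by (rule integral_mult_right_zero)
  finally show ?thesis unfolding lct_def[of "cnj A"] ft_def by (simp only: mult_ac)
qed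

lemma chirp_integral_measurable [measurable]:
  assumes [measurable]: "f \<in> borel_measurable borel" 
  shows "(\<lambda>x. chirp_integral \<gamma> (f x) m) \<in> borel_measurable borel"
  unfolding chirp_integral_def by measurable

text \<open>The composite is found backwards: the parameters of the candidate are chosen so that the
  adjoint of the outer kernel maps it to the output of the inner one, and the extension criterion
  does the rest.\<close>

lemma lct_compose:
  assumes a1: "a1 \<noteq> 0" and A1: "(cmod A1)\<^sup>2 * (2 * pi) = \<bar>a1\<bar>"
    and a: "a \<noteq> 0" and A: "(cmod A)\<^sup>2 * (2 * pi) = \<bar>a\<bar>" and pq: "p1 + q \<noteq> 0"
  obtains A3 p3 q3 a3 where "a3 \<noteq> 0"
    "\<And>h. bcs h \<Longrightarrow> (\<lambda>n. \<integral>\<^sup>+ \<xi>. ennreal ((cmod (lct A p q a (trunc n (lct A1 p1 q1 a1 h)) \<xi>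
        - lct A3 p3 q3 a3 h \<xi>))\<^sup>2) \<partial>lborel) \<longlonglongrightarrow> 0"
proof -
  \<comment> \<open>After the chirp limit, the adjoint of the outer kernel applied to the candidate
    has phase - q x^2 + q3 \<eta>^2 - (a3 \<eta> - a x)^2 / (4 \<delta>). Equating it with p1 x^2 +
    a1 x \<eta> + q1 \<eta>^2 determines \<open>\<delta>\<close>, \<open>a3\<close> and
    \<open>q3\<close>; the quotient makes sense because p1 + q is nonzero.\<close>
  define \<delta> where "\<delta> = - a\<^sup>2 / (4 * (p1 + q))"
  have \<delta>: "\<delta> \<noteq> 0" "- q - a\<^sup>2 / (4 * \<delta>) = p1" using a pq by (auto simp: \<delta>_def field_simps)
  obtain \<kappa> B where \<kappa>: "(cmod \<kappa>)\<^sup>2 = pi / \<bar>\<delta>\<bar>" "\<And>b m. m \<ge> 0 \<Longrightarrow> cmod (chirp_integral \<delta> b m) \<le> B"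
    "\<And>b. (chirp_integral \<delta> b \<longlongrightarrow> \<kappa> * cis (- b\<^sup>2 / (4 * \<delta>))) at_top"
    using chirp_integral_limit[OF \<delta>(1)] by blast
  have nz: "A \<noteq> 0" "A1 \<noteq> 0" "\<kappa> \<noteq> 0" using A A1 \<kappa>(1) a a1 \<delta>(1) by auto
  have B: "B \<ge> 0" using order_trans[OF norm_ge_zero \<kappa>(2)[of 0]] by simp
  define a3 where "a3 = 2 * \<delta> * a1 / a"
  define p3 where "p3 = p + \<delta>"
  define q3 where "q3 = q1 + a3\<^sup>2 / (4 * \<delta>)"
  \<comment> \<open>Cancels the constants \<open>cnj A\<close> of the adjoint and
    \<open>\<kappa>\<close> of the chirp limit, leaving \<open>A1\<close>.\<close>
  define A3 where "A3 = A1 / (cnj A * \<kappa>)"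
  have a3: "a3 \<noteq> 0" using \<delta>(1) a a1 by (simp add: a3_def)
  have "(\<lambda>n. \<integral>\<^sup>+ \<xi>. ennreal ((cmod (lct A p q a (trunc n (lct A1 p1 q1 a1 h)) \<xi> - lct A3 p3 q3 a3 h \<xi>))\<^sup>2) \<partial>lborel) \<longlonglongrightarrow> 0"
    if h: "bcs h" for h
  proof (rule lct_extension[OF a A])
    have [measurable]: "h \<in> borel_measurable borel" by (rule bcs_measurable[OF h])
    let ?u = "lct A1 p1 q1 a1 h" and ?G = "lct A3 p3 q3 a3 h"
    show "L2 ?u" "L2 ?G" by (intro lct_plancherel h a1 a3)+
    show "locally_bounded ?u" "locally_bounded ?G" by (intro locally_bounded_lct h)+
    \<comment> \<open>Here the modulus of the Fresnel limit enters: it makes the candidate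
      isometric, as the norm condition of the criterion demands.\<close>
    have "(cmod A3)\<^sup>2 * (2 * pi) = \<bar>a3\<bar>"
    proof -
      have "(cmod A3)\<^sup>2 = (cmod A1)\<^sup>2 * \<bar>\<delta>\<bar> / ((cmod A)\<^sup>2 * pi)"
        using \<kappa>(1) \<delta>(1) by (simp add: A3_def norm_divide norm_mult power_divide power_mult_distrib)
      also have "\<dots> * (2 * pi) = 2 * \<bar>\<delta>\<bar> * ((cmod A1)\<^sup>2 * (2 * pi)) / ((cmod A)\<^sup>2 * (2 * pi))"
        by simp
      also have "\<dots> = \<bar>a3\<bar>" unfolding A A1 a3_def by (simp add: abs_mult)
      finally show ?thesis .
    qed
    then show "(LINT x|lborel. (cmod (?G x))\<^sup>2) = (LINT x|lborel. (cmod (?u x))\<^sup>2)"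
      by (simp only: lct_isometry[OF h a3] lct_isometry[OF h a1 A1])
    have d: "p3 - p = \<delta>" by (simp add: p3_def)
    show "cmod (lct (cnj A) (- q) (- p) (- a) (trunc m ?G) x) \<le> cmod A * cmod A3 * (LINT \<eta>|lborel. cmod (h \<eta>) * B)" for m x
      unfolding lct_trunc_lct[OF h] d norm_mult complex_mod_cnj norm_cis mult_1_right
    proof (intro mult_left_mono)
      have "cmod (LINT \<eta>|lborel. cis (q3 * \<eta>\<^sup>2) * h \<eta> * chirp_integral \<delta> (a3 * \<eta> - a * x) m)
        \<le> (LINT \<eta>|lborel. cmod (cis (q3 * \<eta>\<^sup>2) * h \<eta> * chirp_integral \<delta> (a3 * \<eta> - a * x) m))"
        by (rule integral_norm_bound)
      also have "\<dots> \<le> (LINT \<eta>|lborel. cmod (h \<eta>) * B)"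
      proof (rule integral_mono')
        show "integrable lborel (\<lambda>\<eta>. cmod (h \<eta>) * B)"
          by (intro integrable_mult_left integrable_norm bcs_integrable h)
        show "cmod (cis (q3 * \<eta>\<^sup>2) * h \<eta> * chirp_integral \<delta> (a3 * \<eta> - a * x) m) \<le> cmod (h \<eta>) * B" for \<eta>
          unfolding norm_mult norm_cis mult_1_left by (rule mult_left_mono[OF \<kappa>(2)]) simp_all
        show "0 \<le> cmod (h \<eta>) * B" for \<eta> using B by simp
      qed
      finally show "cmod (LINT \<eta>|lborel. cis (q3 * \<eta>\<^sup>2) * h \<eta> * chirp_integral \<delta> (a3 * \<eta> - a * x) m) \<le> (LINT \<eta>|lborel. cmod (h \<eta>) * B)" .
    qed simp
    show "(\<lambda>m. lct (cnj A) (- q) (- p) (- a) (trunc m ?G) x) \<longlonglongrightarrow> ?u x" for x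
    proof -
      have "(\<lambda>m. LINT \<eta>|lborel. cis (q3 * \<eta>\<^sup>2) * h \<eta> * chirp_integral \<delta> (a3 * \<eta> - a * x) (real m)) \<longlonglongrightarrow>
        (LINT \<eta>|lborel. cis (q3 * \<eta>\<^sup>2) * h \<eta> * (\<kappa> * cis (- (a3 * \<eta> - a * x)\<^sup>2 / (4 * \<delta>))))"
      proof (rule integral_dominated_convergence)
        show "integrable lborel (\<lambda>\<eta>. cmod (h \<eta>) * B)"
          by (intro integrable_mult_left integrable_norm bcs_integrable h)
        show "AE \<eta> in lborel. cmod (cis (q3 * \<eta>\<^sup>2) * h \<eta> * chirp_integral \<delta> (a3 * \<eta> - a * x) (real m)) \<le> cmod (h \<eta>) * B" for m
          unfolding norm_mult norm_cis mult_1_left by (intro AE_I2 mult_left_mono[OF \<kappa>(2)]) simp_all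
        show "AE \<eta> in lborel. (\<lambda>m. cis (q3 * \<eta>\<^sup>2) * h \<eta> * chirp_integral \<delta> (a3 * \<eta> - a * x) (real m)) \<longlonglongrightarrow>
           cis (q3 * \<eta>\<^sup>2) * h \<eta> * (\<kappa> * cis (- (a3 * \<eta> - a * x)\<^sup>2 / (4 * \<delta>)))"
          by (intro AE_I2 tendsto_mult tendsto_const filterlim_compose[OF \<kappa>(3) filterlim_real_sequentially])
      qed measurable
      also have "(LINT \<eta>|lborel. cis (q3 * \<eta>\<^sup>2) * h \<eta> * (\<kappa> * cis (- (a3 * \<eta> - a * x)\<^sup>2 / (4 * \<delta>)))) =
        (LINT \<eta>|lborel. \<kappa> * cis (- a\<^sup>2 / (4 * \<delta>) * x\<^sup>2) * (cis (a1 * \<eta> * x) * (cis (q1 * \<eta>\<^sup>2) * h \<eta>)))"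
      proof (rule Bochner_Integration.integral_cong[OF refl])
        fix \<eta>
        have "a1 = a3 * a / (2 * \<delta>)" using a \<delta>(1) by (simp add: a3_def)
        then have "q3 * \<eta>\<^sup>2 + - (a3 * \<eta> - a * x)\<^sup>2 / (4 * \<delta>) = - a\<^sup>2 / (4 * \<delta>) * x\<^sup>2 + (a1 * \<eta> * x + q1 * \<eta>\<^sup>2)"
          using \<delta>(1) by (simp add: q3_def power2_eq_square field_simps)
        then have e: "cis (q3 * \<eta>\<^sup>2) * cis (- (a3 * \<eta> - a * x)\<^sup>2 / (4 * \<delta>)) = cis (- a\<^sup>2 / (4 * \<delta>) * x\<^sup>2) * (cis (a1 * \<eta> * x) * cis (q1 * \<eta>\<^sup>2))"
          by (simp only: cis_mult)
        have ac: "x * z * (k * y) = k * u * (v * (w * z))" if "x * y = u * (v * w)" for x y z k u v w :: complex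
        proof -
          have "x * z * (k * y) = (x * y) * (k * z)" by (simp only: mult_ac)
          also have "\<dots> = k * u * (v * (w * z))" unfolding that by (simp only: mult_ac)
          finally show ?thesis .
        qed
        show "cis (q3 * \<eta>\<^sup>2) * h \<eta> * (\<kappa> * cis (- (a3 * \<eta> - a * x)\<^sup>2 / (4 * \<delta>))) =
          \<kappa> * cis (- a\<^sup>2 / (4 * \<delta>) * x\<^sup>2) * (cis (a1 * \<eta> * x) * (cis (q1 * \<eta>\<^sup>2) * h \<eta>))"
          by (rule ac[OF e])
      qed
      also have "\<dots> = \<kappa> * cis (- a\<^sup>2 / (4 * \<delta>) * x\<^sup>2) * ft a1 (\<lambda>x. cis (q1 * x\<^sup>2) * h x) x"
        unfolding ft_def by (rule integral_mult_right_zero)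
      finally have "(\<lambda>m. lct (cnj A) (- q) (- p) (- a) (trunc m ?G) x) \<longlonglongrightarrow>
        cnj A * A3 * cis (- q * x\<^sup>2) * (\<kappa> * cis (- a\<^sup>2 / (4 * \<delta>) * x\<^sup>2) * ft a1 (\<lambda>x. cis (q1 * x\<^sup>2) * h x) x)"
        unfolding lct_trunc_lct[OF h] d by (intro tendsto_intros)
      also have "cnj A * A3 * cis (- q * x\<^sup>2) * (\<kappa> * cis (- a\<^sup>2 / (4 * \<delta>) * x\<^sup>2) * ft a1 (\<lambda>x. cis (q1 * x\<^sup>2) * h x) x) = ?u x"
      proof -
        have 1: "cnj A * A3 * \<kappa> = A1" using nz by (simp add: A3_def)
        have 2: "cis (- q * x\<^sup>2) * cis (- a\<^sup>2 / (4 * \<delta>) * x\<^sup>2) = cis (p1 * x\<^sup>2)"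
          unfolding cis_mult \<delta>(2)[symmetric] by (simp add: algebra_simps)
        show ?thesis unfolding lct_def 1[symmetric] 2[symmetric] by (simp only: mult_ac)
      qed
      finally show ?thesis .
    qed
  qed
  then show ?thesis using that a3 by blast
qed

section \<open>The fractional Fourier transform\<close>

lemma frft_int_zero: "frft_int 0 f = f"
proof -
  have "(THE k::int. 0 = real_of_int k * pi) = 0" by (rule the_equality) auto
  moreover have "0 \<in> range (\<lambda>k::int. real_of_int k * pi)" by (rule range_eqI[of _ _ 0]) simp
  ultimately show ?thesis by (simp add: frft_int_def fun_eq_iff)
qed

definition frft_const :: "real \<Rightarrow> complex" where
  "frft_const \<alpha> = exp (\<i> / 2 * complex_of_real (\<alpha> - sgn \<alpha> * pi / 4)) / complex_of_real (sqrt \<bar>sin \<alpha>\<bar>)"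

lemma frft_int_eq_lct:
  assumes "0 < \<alpha>" "\<alpha> \<le> pi / 2"
  shows "frft_int \<alpha> f = lct (frft_const \<alpha>) (- pi * cot \<alpha>) (- pi * cot \<alpha>) (- 2 * pi / sin \<alpha>) f"
proof -
  have "\<alpha> \<notin> range (\<lambda>k::int. real_of_int k * pi)"
  proof
    assume "\<alpha> \<in> range (\<lambda>k::int. real_of_int k * pi)"
    then obtain k :: int where k: "\<alpha> = real_of_int k * pi" by auto
    have "0 < k" using assms(1) k by (simp add: zero_less_mult_iff)
    then have "1 * pi \<le> real_of_int k * pi" by (intro mult_right_mono) auto
    then show False using assms(2) k pi_gt_zero by linarith
  qed
  then show ?thesis
    by (simp add: frft_int_def lct_def ft_def frft_const_def fun_eq_iff cis_conv_exp mult_ac)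
qed

lemma frft_const_isometric:
  assumes "0 < \<alpha>" "\<alpha> \<le> pi / 2"
  shows "- 2 * pi / sin \<alpha> \<noteq> 0" "(cmod (frft_const \<alpha>))\<^sup>2 * (2 * pi) = \<bar>- 2 * pi / sin \<alpha>\<bar>"
proof -
  have s: "sin \<alpha> > 0" using assms pi_gt_zero by (intro sin_gt_zero) linarith+
  then show "- 2 * pi / sin \<alpha> \<noteq> 0" by simp
  have "cmod (exp (\<i> / 2 * complex_of_real (\<alpha> - sgn \<alpha> * pi / 4))) = 1"
    by (simp add: norm_exp_eq_Re)
  then have "(cmod (frft_const \<alpha>))\<^sup>2 = 1 / sin \<alpha>"
    using s by (simp add: frft_const_def norm_divide power_divide)
  then show "(cmod (frft_const \<alpha>))\<^sup>2 * (2 * pi) = \<bar>- 2 * pi / sin \<alpha>\<bar>" using s by simp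
qed

section \<open>Additivity and uniqueness of the L^2 transform\<close>

lemma frft_int_measurable:
  assumes "0 \<le> \<alpha>" "\<alpha> \<le> pi / 2" "f \<in> borel_measurable borel"
  shows "frft_int \<alpha> f \<in> borel_measurable borel"
  using assms by (cases "\<alpha> = 0") (simp_all add: frft_int_zero frft_int_eq_lct lct_measurable)

lemma L2_trunc_integrable:
  assumes "L2 f" shows "integrable lborel (trunc n f)"
proof (rule Bochner_Integration.integrable_bound)
  show "integrable lborel (\<lambda>x. indicator {- real n..real n} x + (cmod (f x))\<^sup>2)"
    using assms by (intro Bochner_Integration.integrable_add integrable_real_indicator) (auto simp: L2_def emeasure_lborel_Icc_eq)
  show "trunc n f \<in> borel_measurable lborel" using trunc_measurable[OF L2_measurable[OF assms]] by simp
  have "z \<le> 1 + z\<^sup>2" for z :: real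
    using sum_squares_bound[of z 1] zero_le_power2[of z] by (cases "z \<ge> 0") (simp, linarith+)
  then show "AE x in lborel. cmod (trunc n f x) \<le> norm (indicator {- real n..real n} x + (cmod (f x))\<^sup>2)"
    by (intro AE_I2) (auto simp: trunc_def indicator_def)
qed

lemma frft_int_trunc_add:
  assumes "0 \<le> \<alpha>" "\<alpha> \<le> pi / 2" "L2 f" "L2 g"
  shows "frft_int \<alpha> (trunc n (\<lambda>x. f x + g x)) \<xi> = frft_int \<alpha> (trunc n f) \<xi> + frft_int \<alpha> (trunc n g) \<xi>"
proof (cases "\<alpha> = 0")
  case True
  then show ?thesis by (simp add: frft_int_zero trunc_def)
next
  case False
  then have \<alpha>: "0 < \<alpha>" "\<alpha> \<le> pi / 2" using assms by auto
  have "ft a (\<lambda>x. cis (q * x\<^sup>2) * trunc n (\<lambda>x. f x + g x) x) \<xi> =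
    ft a (\<lambda>x. cis (q * x\<^sup>2) * trunc n f x) \<xi> + ft a (\<lambda>x. cis (q * x\<^sup>2) * trunc n g x) \<xi>" for a q
  proof -
    have i: "integrable lborel (\<lambda>x. cis (a * x * \<xi>) * (cis (q * x\<^sup>2) * trunc n h x))" if "L2 h" for h
    proof (rule Bochner_Integration.integrable_bound[OF L2_trunc_integrable[OF that, of n]])
      have [measurable]: "trunc n h \<in> borel_measurable borel" by (rule trunc_measurable[OF L2_measurable[OF that]])
      show "(\<lambda>x. cis (a * x * \<xi>) * (cis (q * x\<^sup>2) * trunc n h x)) \<in> borel_measurable lborel" by measurable
    qed (simp add: norm_mult)
    have "trunc n (\<lambda>x. f x + g x) x = trunc n f x + trunc n g x" for x by (simp add: trunc_def)
    then show ?thesis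
      unfolding ft_def by (simp only: distrib_left Bochner_Integration.integral_add[OF i[OF assms(3)] i[OF assms(4)]])
  qed
  then show ?thesis by (simp only: frft_int_eq_lct[OF \<alpha>] lct_def distrib_left)
qed

text \<open>A crude stand-in for Minkowski's inequality; the factors 2 are harmless when both terms
  tend to 0.\<close>

lemma nn_integral_cmod_add_power2_le:
  assumes [measurable]: "u \<in> borel_measurable borel" "v \<in> borel_measurable borel"
  shows "(\<integral>\<^sup>+ x. ennreal ((cmod (u x + v x))\<^sup>2) \<partial>lborel) \<le>
    2 * (\<integral>\<^sup>+ x. ennreal ((cmod (u x))\<^sup>2) \<partial>lborel) + 2 * (\<integral>\<^sup>+ x. ennreal ((cmod (v x))\<^sup>2) \<partial>lborel)"
proof -
  have "(cmod (u x + v x))\<^sup>2 \<le> 2 * (cmod (u x))\<^sup>2 + 2 * (cmod (v x))\<^sup>2" for x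
  proof -
    have "(cmod (u x + v x))\<^sup>2 \<le> (cmod (u x) + cmod (v x))\<^sup>2"
      by (intro power_mono norm_triangle_ineq) simp
    then show ?thesis using sum_squares_bound[of "cmod (u x)" "cmod (v x)"] by (simp add: power2_sum)
  qed
  have "ennreal ((cmod (u x + v x))\<^sup>2) \<le> 2 * ennreal ((cmod (u x))\<^sup>2) + 2 * ennreal ((cmod (v x))\<^sup>2)" for x
  proof -
    have "ennreal ((cmod (u x + v x))\<^sup>2) \<le> ennreal (2 * (cmod (u x))\<^sup>2 + 2 * (cmod (v x))\<^sup>2)"
      by (rule ennreal_leI) fact
    also have "\<dots> = 2 * ennreal ((cmod (u x))\<^sup>2) + 2 * ennreal ((cmod (v x))\<^sup>2)"
      by (simp add: ennreal_plus ennreal_mult)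
    finally show ?thesis .
  qed
  from nn_integral_mono[OF this]
  have "(\<integral>\<^sup>+ x. ennreal ((cmod (u x + v x))\<^sup>2) \<partial>lborel) \<le>
     (\<integral>\<^sup>+ x. 2 * ennreal ((cmod (u x))\<^sup>2) + 2 * ennreal ((cmod (v x))\<^sup>2) \<partial>lborel)"
    .
  also have "\<dots> = 2 * (\<integral>\<^sup>+ x. ennreal ((cmod (u x))\<^sup>2) \<partial>lborel) + 2 * (\<integral>\<^sup>+ x. ennreal ((cmod (v x))\<^sup>2) \<partial>lborel)"
    by (subst nn_integral_add) (simp_all add: nn_integral_cmult)
  finally show ?thesis .
qed

lemma tendsto_two_mult_add_zero:
  fixes a b :: "nat \<Rightarrow> ennreal"
  assumes "a \<longlonglongrightarrow> 0" "b \<longlonglongrightarrow> 0" shows "(\<lambda>n. 2 * a n + 2 * b n) \<longlonglongrightarrow> 0"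
proof -
  have "(\<lambda>n. 2 * a n + 2 * b n) \<longlonglongrightarrow> 2 * 0 + 2 * 0"
    by (intro tendsto_add ennreal_tendsto_cmult assms) auto
  then show ?thesis by simp
qed

lemma frft_L2_add:
  assumes \<alpha>: "0 \<le> \<alpha>" "\<alpha> \<le> pi / 2" and "L2 f" "L2 f'" "frft_L2 \<alpha> f g" "frft_L2 \<alpha> f' g'"
  shows "frft_L2 \<alpha> (\<lambda>x. f x + f' x) (\<lambda>x. g x + g' x)"
proof -
  let ?d = "\<lambda>f g n. \<integral>\<^sup>+ \<xi>. ennreal ((cmod (frft_int \<alpha> (trunc n f) \<xi> - g \<xi>))\<^sup>2) \<partial>lborel"
  have g: "L2 g" "L2 g'" "?d f g \<longlonglongrightarrow> 0" "?d f' g' \<longlonglongrightarrow> 0" using assms(5,6) by (auto simp: frft_L2_def)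
  have m: "frft_int \<alpha> (trunc n f) \<in> borel_measurable borel" "frft_int \<alpha> (trunc n f') \<in> borel_measurable borel" for n
    by (intro frft_int_measurable \<alpha> trunc_measurable L2_measurable assms)+
  have "?d (\<lambda>x. f x + f' x) (\<lambda>x. g x + g' x) n \<le> 2 * ?d f g n + 2 * ?d f' g' n" for n
  proof -
    have "frft_int \<alpha> (trunc n (\<lambda>x. f x + f' x)) \<xi> - (g \<xi> + g' \<xi>) = 
      (frft_int \<alpha> (trunc n f) \<xi> - g \<xi>) + (frft_int \<alpha> (trunc n f') \<xi> - g' \<xi>)" for \<xi>
      using frft_int_trunc_add[OF \<alpha> assms(3,4)] by simp
    then show ?thesis
      by (simp only: nn_integral_cmod_add_power2_le[OF borel_measurable_diff[OF m(1) L2_measurable[OF g(1)]] borel_measurable_diff[OF m(2) L2_measurable[OF g(2)]]])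
  qed
  then have "?d (\<lambda>x. f x + f' x) (\<lambda>x. g x + g' x) \<longlonglongrightarrow> 0"
    by (intro tendsto_sandwich[OF always_eventually always_eventually tendsto_const tendsto_two_mult_add_zero[OF g(3,4)]]) auto
  then show ?thesis using L2_add[OF g(1,2)] by (simp add: frft_L2_def)
qed

lemma L2_sum: "finite J \<Longrightarrow> (\<And>j. j \<in> J \<Longrightarrow> L2 (f j)) \<Longrightarrow> L2 (\<lambda>x. \<Sum>j\<in>J. f j x)"
  by (induction J rule: finite_induct) (simp_all add: L2_zero L2_add)

lemma frft_L2_zero:
  assumes \<alpha>: "0 \<le> \<alpha>" "\<alpha> \<le> pi / 2" shows "frft_L2 \<alpha> (\<lambda>x. 0) (\<lambda>x. 0)"
proof -
  have "frft_int \<alpha> (trunc n (\<lambda>x. 0)) = (\<lambda>x. 0)" for n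
    using assms by (cases "\<alpha> = 0") (simp_all add: frft_int_zero frft_int_eq_lct trunc_def[abs_def] lct_def ft_def fun_eq_iff)
  then show ?thesis by (simp add: frft_L2_def L2_zero)
qed

lemma frft_L2_sum:
  assumes \<alpha>: "0 \<le> \<alpha>" "\<alpha> \<le> pi / 2" and "finite J" "\<And>j. j \<in> J \<Longrightarrow> L2 (f j)" "\<And>j. j \<in> J \<Longrightarrow> frft_L2 \<alpha> (f j) (g j)"
  shows "frft_L2 \<alpha> (\<lambda>x. \<Sum>j\<in>J. f j x) (\<lambda>x. \<Sum>j\<in>J. g j x)"
  using assms(3,4,5)
proof (induction J rule: finite_induct)
  case empty
  then show ?case by (simp add: frft_L2_zero[OF \<alpha>])
next
  case (insert j J)
  then have "L2 (f j)" "L2 (\<lambda>x. \<Sum>j\<in>J. f j x)" "frft_L2 \<alpha> (f j) (g j)" "frft_L2 \<alpha> (\<lambda>x. \<Sum>j\<in>J. f j x) (\<lambda>x. \<Sum>j\<in>J. g j x)"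
    by (auto intro: L2_sum)
  from frft_L2_add[OF \<alpha> this] insert(1,2) show ?case by simp
qed

text \<open>Both functions are L^2 limits of the same sequence: g - g' splits into (T_n - g') + (g -
  T_n), with T_n the transform of the n-th truncation.\<close>

lemma frft_L2_unique:
  assumes \<alpha>: "0 \<le> \<alpha>" "\<alpha> \<le> pi / 2" and "L2 f" "frft_L2 \<alpha> f g" "frft_L2 \<alpha> f g'"
  shows "AE x in lborel. g x = g' x"
proof -
  let ?d = "\<lambda>g n. \<integral>\<^sup>+ \<xi>. ennreal ((cmod (frft_int \<alpha> (trunc n f) \<xi> - g \<xi>))\<^sup>2) \<partial>lborel"
  have g: "L2 g" "L2 g'" "?d g \<longlonglongrightarrow> 0" "?d g' \<longlonglongrightarrow> 0" using assms(4,5) by (auto simp: frft_L2_def)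
  have [measurable]: "g \<in> borel_measurable borel" "g' \<in> borel_measurable borel"
    by (intro L2_measurable g)+
  have m: "frft_int \<alpha> (trunc n f) \<in> borel_measurable borel" for n
    by (intro frft_int_measurable \<alpha> trunc_measurable L2_measurable assms)+
  let ?e = "\<integral>\<^sup>+ x. ennreal ((cmod (g x - g' x))\<^sup>2) \<partial>lborel"
  have "?e \<le> 2 * ?d g' n + 2 * ?d g n" for n
    using nn_integral_cmod_add_power2_le[OF borel_measurable_diff[OF m[of n] L2_measurable[OF g(2)]] borel_measurable_diff[OF L2_measurable[OF g(1)] m[of n]]]
    by (simp add: norm_minus_commute[of "g _"])
  then have "?e \<le> 0"
    by (intro LIMSEQ_le_const[OF tendsto_two_mult_add_zero[OF g(4,3)]]) auto
  then have "AE x in lborel. ennreal ((cmod (g x - g' x))\<^sup>2) = 0"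
    by (subst nn_integral_0_iff_AE[symmetric]) auto
  then show ?thesis by eventually_elim (simp add: ennreal_eq_0_iff)
qed

text \<open>At angle 0 the transform of a truncation is the truncation itself, so this is the L^2
  convergence of truncations, dominated by |f|^2.\<close>

lemma frft_L2_zero_angle:
  assumes "L2 f" shows "frft_L2 0 f f"
proof -
  have [measurable]: "f \<in> borel_measurable borel" by (rule L2_measurable[OF assms])
  have [measurable]: "trunc n f \<in> borel_measurable borel" for n by (rule trunc_measurable) measurable
  have "(\<lambda>n. LINT x|lborel. (cmod (trunc n f x - f x))\<^sup>2) \<longlonglongrightarrow> (LINT x::real|lborel. (0::real))"
  proof (rule integral_dominated_convergence)
    show "integrable lborel (\<lambda>x. (cmod (f x))\<^sup>2)" using assms by (simp add: L2_def)
    show "AE x in lborel. (\<lambda>n. (cmod (trunc n f x - f x))\<^sup>2) \<longlonglongrightarrow> 0"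
    proof (rule AE_I2)
      fix x
      have "(\<lambda>n. (cmod (trunc n f x - f x))\<^sup>2) \<longlonglongrightarrow> (cmod (f x - f x))\<^sup>2"
        by (intro tendsto_intros trunc_tendsto)
      then show "(\<lambda>n. (cmod (trunc n f x - f x))\<^sup>2) \<longlonglongrightarrow> 0" by simp
    qed
    show "AE x in lborel. norm ((cmod (trunc n f x - f x))\<^sup>2) \<le> (cmod (f x))\<^sup>2" for n
      by (intro AE_I2) (simp add: trunc_def)
  qed measurable
  from tendsto_ennrealI[OF this] show ?thesis
    using assms L2_diff_norm(1)[OF L2_trunc[OF assms] assms]
    by (simp add: frft_L2_def frft_int_zero nn_integral_eq_integral)
qed

text \<open>The adjoint of the transform of angle $\alpha \in [0, \pi/2]$.\<close>

definition frft_inv :: "real \<Rightarrow> (real \<Rightarrow> complex) \<Rightarrow> real \<Rightarrow> complex" where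
  "frft_inv \<alpha> h = (if \<alpha> = 0 then h else lct (cnj (frft_const \<alpha>)) (pi * cot \<alpha>) (pi * cot \<alpha>) (2 * pi / sin \<alpha>) h)"

lemma L2_frft_inv:
  assumes "0 \<le> \<alpha>" "\<alpha> \<le> pi / 2" "bcs h" shows "L2 (frft_inv \<alpha> h)"
proof (cases "\<alpha> = 0")
  case False
  then have "2 * pi / sin \<alpha> \<noteq> 0" using frft_const_isometric(1)[of \<alpha>] assms by auto
  with False show ?thesis using lct_plancherel(1)[OF assms(3)] by (simp add: frft_inv_def)
qed (simp add: frft_inv_def L2_bcs assms)

lemma frft_L2_frft_inv:
  assumes "0 \<le> \<alpha>" "\<alpha> \<le> pi / 2" "bcs h" shows "frft_L2 \<alpha> (frft_inv \<alpha> h) h"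
proof (cases "\<alpha> = 0")
  case True
  then show ?thesis by (simp add: frft_inv_def frft_L2_zero_angle L2_bcs assms)
next
  case False
  with assms have \<alpha>: "0 < \<alpha>" "\<alpha> \<le> pi / 2" by auto
  from lct_inverse[OF frft_const_isometric[OF \<alpha>] assms(3), of "- pi * cot \<alpha>" "- pi * cot \<alpha>"] False
  show ?thesis by (simp add: frft_L2_def frft_inv_def frft_int_eq_lct[OF \<alpha>] L2_bcs[OF assms(3)])
qed

section \<open>Cross terms between two angles\<close>

text \<open>If one of the angles is 0, the product is just the transform of angle \<beta> or the
  inverse of angle \<alpha>. For two positive angles the kernels compose, the nonvanishing sum p1 +
  q being pi (cot \<alpha> - cot \<beta>).\<close>

lemma frft_L2_frft_inv_lct:
  assumes \<alpha>: "0 \<le> \<alpha>" "\<alpha> \<le> pi / 2" and \<beta>: "0 \<le> \<beta>" "\<beta> \<le> pi / 2" and neq: "\<alpha> \<noteq> \<beta>"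
  obtains A p q a where "a \<noteq> 0" "\<And>h. bcs h \<Longrightarrow> frft_L2 \<beta> (frft_inv \<alpha> h) (lct A p q a h)"
proof -
  consider "\<alpha> = 0" "0 < \<beta>" | "0 < \<alpha>" "\<beta> = 0" | "0 < \<alpha>" "0 < \<beta>" using \<alpha> \<beta> neq by linarith
  then show thesis
  proof cases
    case 1
    note a = frft_const_isometric(1)[OF 1(2) \<beta>(2)]
    show thesis
    proof (rule that[OF a])
      fix h assume h: "bcs h"
      \<comment> \<open>For large n the truncation leaves \<open>h\<close> unchanged, so the
        sequence of distances is eventually 0.\<close>
      have "eventually (\<lambda>n. (\<integral>\<^sup>+ \<xi>. ennreal ((cmod (frft_int \<beta> (trunc n h) \<xi> - frft_int \<beta> h \<xi>))\<^sup>2) \<partial>lborel) = 0) sequentially"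
        using trunc_bcs_eventually[OF h] by eventually_elim simp
      then show "frft_L2 \<beta> (frft_inv \<alpha> h) (lct (frft_const \<beta>) (- pi * cot \<beta>) (- pi * cot \<beta>) (- 2 * pi / sin \<beta>) h)"
        using lct_plancherel(1)[OF h a] 1
        by (simp add: frft_L2_def frft_inv_def frft_int_eq_lct[OF 1(2) \<beta>(2)] tendsto_eventually)
    qed
  next
    case 2
    then have "2 * pi / sin \<alpha> \<noteq> 0" using frft_const_isometric(1)[OF 2(1) \<alpha>(2)] by auto
    then show thesis
    proof (rule that)
      fix h assume "bcs h"
      then have "L2 (frft_inv \<alpha> h)" by (rule L2_frft_inv[OF \<alpha>])
      from frft_L2_zero_angle[OF this]
      show "frft_L2 \<beta> (frft_inv \<alpha> h) (lct (cnj (frft_const \<alpha>)) (pi * cot \<alpha>) (pi * cot \<alpha>) (2 * pi / sin \<alpha>) h)"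
        using 2 by (simp add: frft_inv_def)
    qed
  next
    case 3
    have s: "sin \<alpha> > 0" "sin \<beta> > 0" using \<alpha> \<beta> 3 pi_gt_zero by (intro sin_gt_zero; linarith)+
    have "cot \<alpha> \<noteq> cot \<beta>"
    proof
      assume "cot \<alpha> = cot \<beta>"
      then have "cos \<alpha> * sin \<beta> = cos \<beta> * sin \<alpha>" 
        using frac_eq_eq[of "sin \<alpha>" "sin \<beta>" "cos \<alpha>" "cos \<beta>"] s unfolding cot_def by linarith
      then have "sin (\<alpha> - \<beta>) = 0" by (simp only: sin_diff mult.commute diff_self)
      moreover have "- pi < \<alpha> - \<beta>" "\<alpha> - \<beta> < pi" using \<alpha> \<beta> pi_gt_zero by linarith+
      ultimately have "\<alpha> - \<beta> = 0" using sin_eq_0_pi[of "\<alpha> - \<beta>"] by blast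
      with neq show False by (simp only: right_minus_eq)
    qed
    then have "pi * (cot \<alpha> - cot \<beta>) \<noteq> 0"
      by (simp only: mult_eq_0_iff pi_neq_zero right_minus_eq simp_thms)
    then have pq: "pi * cot \<alpha> + - pi * cot \<beta> \<noteq> 0" 
      by (simp only: distrib_left mult_minus_left mult_minus_right diff_conv_add_uminus not_False_eq_True)
    have a1: "2 * pi / sin \<alpha> \<noteq> 0" "(cmod (cnj (frft_const \<alpha>)))\<^sup>2 * (2 * pi) = \<bar>2 * pi / sin \<alpha>\<bar>"
    proof -
      show "2 * pi / sin \<alpha> \<noteq> 0" using s(1) by simp
      show "(cmod (cnj (frft_const \<alpha>)))\<^sup>2 * (2 * pi) = \<bar>2 * pi / sin \<alpha>\<bar>"
        using frft_const_isometric(2)[OF 3(1) \<alpha>(2)] 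
        by (simp only: complex_mod_cnj mult_minus_left minus_divide_left[symmetric] abs_minus_cancel)
    qed
    obtain A p q a where *: "a \<noteq> 0" "\<And>h. bcs h \<Longrightarrow> (\<lambda>n. \<integral>\<^sup>+ \<xi>. ennreal ((cmod (
        lct (frft_const \<beta>) (- pi * cot \<beta>) (- pi * cot \<beta>) (- 2 * pi / sin \<beta>) (trunc n (lct (cnj (frft_const \<alpha>)) (pi * cot \<alpha>) (pi * cot \<alpha>) (2 * pi / sin \<alpha>) h)) \<xi>
        - lct A p q a h \<xi>))\<^sup>2) \<partial>lborel) \<longlonglongrightarrow> 0"
      by (rule lct_compose[OF a1 frft_const_isometric[OF 3(2) \<beta>(2)] pq, where p = "- pi * cot \<beta>" and ?q1.0 = "pi * cot \<alpha>"])
         (rule that)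
    show thesis
    proof (rule that[OF *(1)])
      fix h assume h: "bcs h"
      show "frft_L2 \<beta> (frft_inv \<alpha> h) (lct A p q a h)"
        using *(2)[OF h] lct_plancherel(1)[OF h *(1)] 3 by (simp add: frft_L2_def frft_inv_def frft_int_eq_lct[OF 3(2) \<beta>(2)])
    qed
  qed
qed

text \<open>Once N exceeds |a| (|M| + |T|), the window [-T, T] translated by N / a lies entirely
  beyond the Riemann-Lebesgue threshold M.\<close>

lemma lct_modulate_small:
  assumes h: "bcs h" and a: "a \<noteq> 0" and e: "e > 0"
  shows "eventually (\<lambda>N. \<forall>\<xi>. \<bar>\<xi>\<bar> \<le> T \<longrightarrow> cmod (lct A p q a (\<lambda>x. cis (N * x) * h x) \<xi>) \<le> e) at_top"
proof -
  \<comment> \<open>The \<open>+ 1\<close> covers the case A = 0.\<close>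
  have e': "e / (cmod A + 1) > 0" using e by (intro divide_pos_pos add_nonneg_pos) auto
  have b: "bcs (\<lambda>x. cis (q * x\<^sup>2) * h x)" by (rule bcs_cis_mult[OF h]) measurable
  obtain M where M: "\<And>t. M \<le> \<bar>t\<bar> \<Longrightarrow> cmod (ft a (\<lambda>x. cis (q * x\<^sup>2) * h x) t) < e / (cmod A + 1)"
    by (rule riemann_lebesgue[OF b a e']) (rule that)
  show ?thesis
    using eventually_ge_at_top[of "\<bar>a\<bar> * (\<bar>M\<bar> + \<bar>T\<bar>)"]
  proof eventually_elim
    case (elim N)
    show ?case
    proof (intro allI impI)
      fix \<xi> :: real assume \<xi>: "\<bar>\<xi>\<bar> \<le> T"
      have "(\<lambda>x. cis (q * x\<^sup>2) * (cis (N * x) * h x)) = (\<lambda>x. cis (N * x) * (cis (q * x\<^sup>2) * h x))"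
        by (simp only: mult.left_commute)
      then have eq: "cmod (lct A p q a (\<lambda>x. cis (N * x) * h x) \<xi>) = cmod A * cmod (ft a (\<lambda>x. cis (q * x\<^sup>2) * h x) (\<xi> + N / a))"
        unfolding lct_def by (simp only: ft_modulate[OF a] norm_mult norm_cis mult_1_right)
      have "\<bar>M\<bar> + \<bar>T\<bar> \<le> \<bar>N\<bar> / \<bar>a\<bar>"
        using elim a by (subst pos_le_divide_eq) (auto simp: mult.commute)
      then have "\<bar>M\<bar> + \<bar>T\<bar> \<le> \<bar>N / a\<bar>" by (simp only: abs_divide)
      then have "M \<le> \<bar>\<xi> + N / a\<bar>" using \<xi> by linarith
      then have "cmod A * cmod (ft a (\<lambda>x. cis (q * x\<^sup>2) * h x) (\<xi> + N / a)) \<le> (cmod A + 1) * (e / (cmod A + 1))"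
        by (intro mult_mono less_imp_le[OF M]) auto
      also have "\<dots> = e" using norm_ge_zero[of A] by (simp add: add_nonneg_eq_0_iff)
      finally show "cmod (lct A p q a (\<lambda>x. cis (N * x) * h x) \<xi>) \<le> e" unfolding eq .
    qed
  qed
qed

text \<open>The kernel parameters depend on the pair of angles. Hiding them behind an existential
  \<open>g\<close> lets the statements for all pairs be combined at one common N.\<close>

lemma frft_inv_modulate_small:
  assumes \<alpha>: "0 \<le> \<alpha>" "\<alpha> \<le> pi / 2" and \<beta>: "0 \<le> \<beta>" "\<beta> \<le> pi / 2" and neq: "\<alpha> \<noteq> \<beta>" and h: "bcs h" and e: "e > 0"
  shows "eventually (\<lambda>N. \<exists>g. frft_L2 \<beta> (frft_inv \<alpha> (\<lambda>x. cis (N * x) * h x)) g \<and> (\<forall>\<xi>. \<bar>\<xi>\<bar> \<le> T \<longrightarrow> cmod (g \<xi>) \<le> e)) at_top"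
proof -
  obtain A p q a where *: "a \<noteq> 0" "\<And>h. bcs h \<Longrightarrow> frft_L2 \<beta> (frft_inv \<alpha> h) (lct A p q a h)"
    by (rule frft_L2_frft_inv_lct[OF \<alpha> \<beta> neq]) (rule that)
  from lct_modulate_small[OF h *(1) e, of T A p q] show ?thesis
  proof eventually_elim
    case (elim N)
    have "bcs (\<lambda>x. cis (N * x) * h x)" by (rule bcs_cis_mult[OF h]) measurable
    from *(2)[OF this] elim show ?case by blast
  qed
qed

section \<open>Assembly of the approximating function\<close>

theorem mainTheorem4:
  fixes n :: nat and \<alpha> :: "nat \<Rightarrow> real" and T :: real and f :: "nat \<Rightarrow> real \<Rightarrow> real"
  assumes alpha_range: "\<forall>k\<in>{1..n}. 0 \<le> \<alpha> k \<and> \<alpha> k \<le> pi / 2"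
    and alpha_incr: "\<forall>i\<in>{1..n}. \<forall>j\<in>{1..n}. i < j \<longrightarrow> \<alpha> i < \<alpha> j"
    and T_pos: "T > 0"
    and f_meas: "\<forall>j\<in>{1..n}. f j \<in> borel_measurable lborel"
    and f_bdd: "\<forall>j\<in>{1..n}. \<exists>B. AE x in lborel. \<bar>f j x\<bar> \<le> B"
    and f_supp: "\<forall>j\<in>{1..n}. AE x in lborel. x \<notin> {-T..T} \<longrightarrow> f j x = 0"
    and f_nonneg: "\<forall>j\<in>{1..n}. AE x in lborel. f j x \<ge> 0"
    and eps_pos: "\<epsilon> > (0::real)"
  shows "\<exists>\<phi>. L2 \<phi> \<and> (\<forall>k\<in>{1..n}.
            (\<exists>g. frft_L2 (\<alpha> k) \<phi> g) \<and>
            (\<forall>g. frft_L2 (\<alpha> k) \<phi> g \<longrightarrow>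
                 (AE x in lborel. x \<in> {-T..T} \<longrightarrow> \<bar>cmod (g x) - f k x\<bar> \<le> \<epsilon>)))"
proof -
  let ?J = "{1..n}"
  obtain B where B: "\<And>j. j \<in> ?J \<Longrightarrow> AE x in lborel. \<bar>f j x\<bar> \<le> B j" 
    using bchoice[OF f_bdd] by blast
  \<comment> \<open>\<open>f j\<close> is changed on a null set so that the bounds and the support
    hold at every point; on [-T, T] it is unchanged almost everywhere.\<close>
  define h where "h j x = complex_of_real (if x \<in> {-T..T} \<and> \<bar>f j x\<bar> \<le> B j then f j x else 0)" for j x
  have h: "bcs (h j)" if j: "j \<in> ?J" for j
  proof (rule bcsI[where R=T and B="\<bar>B j\<bar>"])
    have [measurable]: "f j \<in> borel_measurable borel" using f_meas j by simp
    show "h j \<in> borel_measurable borel" unfolding h_def[abs_def] by measurable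
  qed (auto simp: h_def)
  have \<alpha>: "0 \<le> \<alpha> j" "\<alpha> j \<le> pi / 2" if "j \<in> ?J" for j using alpha_range that by auto
  have neq: "\<alpha> j \<noteq> \<alpha> k" if "j \<in> ?J" "k \<in> ?J" "j \<noteq> k" for j k
    using alpha_incr that by (metis linorder_neqE_nat less_irrefl)
  \<comment> \<open>For each k there are at most n - 1 cross terms, so e = \<epsilon> / n would be
    enough; the \<open>+ 1\<close> keeps the quotient meaningful for n = 0.\<close>
  define e where "e = \<epsilon> / (real n + 1)"
  have e: "e > 0" "real n * e \<le> \<epsilon>" using eps_pos by (auto simp: e_def field_simps)
  define H where "H N j x = cis (N * x) * h j x" for N j x
  \<comment> \<open>There are finitely many pairs (j, k), so one modulation frequency serves all of
    them.\<close>
  have "eventually (\<lambda>N. \<forall>j\<in>?J. \<forall>k\<in>?J-{j}. \<exists>g. frft_L2 (\<alpha> k) (frft_inv (\<alpha> j) (H N j)) g \<and> (\<forall>\<xi>. \<bar>\<xi>\<bar> \<le> T \<longrightarrow> cmod (g \<xi>) \<le> e)) at_top"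
    unfolding H_def[abs_def]
    by (intro eventually_ball_finite finite_atLeastAtMost finite_Diff ballI frft_inv_modulate_small \<alpha> neq h e(1)) auto
  from eventually_happens'[OF trivial_limit_at_top_linorder this]
  obtain N where N: "\<forall>j\<in>?J. \<forall>k\<in>?J-{j}. \<exists>g. frft_L2 (\<alpha> k) (frft_inv (\<alpha> j) (H N j)) g \<and> (\<forall>\<xi>. \<bar>\<xi>\<bar> \<le> T \<longrightarrow> cmod (g \<xi>) \<le> e)"
    by (elim exE)
  have bH: "bcs (H N j)" if "j \<in> ?J" for j
    unfolding H_def[abs_def] by (rule bcs_cis_mult[OF h[OF that]]) measurable
  \<comment> \<open>On the diagonal the representative is fixed to be \<open>H N k\<close> exactly,
    since its modulus is what must reproduce \<open>f k\<close>.\<close>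
  have "\<exists>g. frft_L2 (\<alpha> k) (frft_inv (\<alpha> j) (H N j)) g \<and> (if j = k then g = H N k else \<forall>\<xi>. \<bar>\<xi>\<bar> \<le> T \<longrightarrow> cmod (g \<xi>) \<le> e)"
    if "j \<in> ?J" "k \<in> ?J" for j k
  proof (cases "j = k")
    case True
    then show ?thesis using frft_L2_frft_inv[OF \<alpha> bH, OF that(1) that(1) that(1)] by auto
  next
    case False
    with N that show ?thesis by simp
  qed
  then obtain G where G: "\<And>j k. j \<in> ?J \<Longrightarrow> k \<in> ?J \<Longrightarrow> frft_L2 (\<alpha> k) (frft_inv (\<alpha> j) (H N j)) (G j k)"
      "\<And>k. k \<in> ?J \<Longrightarrow> G k k = H N k"
      "\<And>j k \<xi>. j \<in> ?J \<Longrightarrow> k \<in> ?J \<Longrightarrow> j \<noteq> k \<Longrightarrow> \<bar>\<xi>\<bar> \<le> T \<Longrightarrow> cmod (G j k \<xi>) \<le> e"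
    by metis
  define \<phi> where "\<phi> x = (\<Sum>j\<in>?J. frft_inv (\<alpha> j) (H N j) x)" for x
  have L: "L2 (frft_inv (\<alpha> j) (H N j))" if "j \<in> ?J" for j using L2_frft_inv[OF \<alpha> bH] that by blast
  have \<phi>: "frft_L2 (\<alpha> k) \<phi> (\<lambda>x. \<Sum>j\<in>?J. G j k x)" if "k \<in> ?J" for k
    unfolding \<phi>_def[abs_def] by (rule frft_L2_sum[OF \<alpha>[OF that] finite_atLeastAtMost L G(1)[OF _ that]])
  have L\<phi>: "L2 \<phi>"
    unfolding \<phi>_def[abs_def] by (rule L2_sum[OF finite_atLeastAtMost L])
  show ?thesis
  proof (rule exI[of _ \<phi>], rule conjI[OF L\<phi>], intro ballI conjI allI impI)
    fix k assume k: "k \<in> ?J"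
    show "\<exists>g. frft_L2 (\<alpha> k) \<phi> g" using \<phi>[OF k] by blast
    fix g assume g: "frft_L2 (\<alpha> k) \<phi> g"
    \<comment> \<open>The claim concerns every representative \<open>g\<close>, so it is first
      replaced by the one built from the kernels.\<close>
    have "AE x in lborel. g x = (\<Sum>j\<in>?J. G j k x)"
      by (rule frft_L2_unique[OF \<alpha>[OF k] L\<phi> g \<phi>[OF k]])
    moreover have "AE x in lborel. f k x \<ge> 0" using f_nonneg k by blast
    ultimately show "AE x in lborel. x \<in> {-T..T} \<longrightarrow> \<bar>cmod (g x) - f k x\<bar> \<le> \<epsilon>"
      using B[OF k]
    proof eventually_elim
      case (elim x)
      show ?case
      proof
        assume x: "x \<in> {-T..T}"
        then have "h k x = complex_of_real (f k x)" using elim by (simp add: h_def)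
        then have fk: "cmod (G k k x) = f k x" using elim G(2)[OF k] by (simp add: H_def norm_mult)
        \<comment> \<open>Splitting off the diagonal term leaves cross terms of size at most
          \<open>e\<close> each; the reverse triangle inequality compares the moduli.\<close>
        have "g x = G k k x + (\<Sum>j\<in>?J - {k}. G j k x)" using elim(1) k by (simp add: sum.remove)
        then have "\<bar>cmod (g x) - cmod (G k k x)\<bar> \<le> cmod (\<Sum>j\<in>?J - {k}. G j k x)"
          using norm_triangle_ineq3[of "g x" "G k k x"] by simp
        also have "\<dots> \<le> (\<Sum>j\<in>?J - {k}. e)"
          using x k by (intro sum_norm_le G(3)) auto
        also have "\<dots> \<le> real n * e" using k e(1) by (simp add: card_Diff_singleton)
        also have "\<dots> \<le> \<epsilon>" by (rule e(2))
        finally show "\<bar>cmod (g x) - f k x\<bar> \<le> \<epsilon>" unfolding fk .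
      qed
    qed
  qed
qed

end
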